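(* Let $r\ge1$. The algebra $B_r$ is tightly graded if and only if $r=1$.
   Context: $k$ is an algebraically closed field of characteristic 2. A finite dimensional $k$-algebra $A$ is tightly graded if there is an algebra isomorphism $A\cong\mathrm{gr}_{\mathrm{rad}A}(A)$, where $\mathrm{gr}_{\mathrm{rad}A}(A)$ is the graded algebra associated with the radical filtration. Equivalently, there is a positive grading $A=\bigoplus_{i\ge0}A_i$ with $A_0$ semisimple and $A$ generated as an algebra by $A_0$ and $A_1$. $B_r$ ($r\ge1$) is the quotient of the path algebra over $k$ (paths written left to right: $xy$ means first $x$, then $y$) of the quiver with vertices $1,2,3$ and arrows $c_1:1\to2$, $c_2:2\to3$, $c_3:3\to1$, $d_1:2\to1$, $d_2:3\to2$, $d_3:1\to3$, by the relations $c_1c_2=c_2c_3=c_3c_1=0$, $d_1d_3=d_3d_2=d_2d_1=0$, $c_1d_1=d_3c_3$, $d_1c_1=(c_2d_2)^r$, $c_3d_3=(d_2c_2)^r$. *)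

theory Defs
  imports
    "HOL-Algebra.Module"
    "HOL-Algebra.QuotRing"
    "HOL-Algebra.Ideal_Product"
    "HOL-Computational_Algebra.Polynomial"
    "Graph_Theory.Arc_Walk"
begin

section \<open>Algebras over a field\<close>

text \<open>
  The ground field is a type, and an algebra over it is a record \<^typ>\<open>('k, 'a) module\<close>, that is, a
  (not necessarily commutative) ring with a scalar multiplication.
\<close>

definition alg_iso :: "('k, 'a) module \<Rightarrow> ('k, 'b) module \<Rightarrow> ('a \<Rightarrow> 'b) set" where
  "alg_iso A B = {h \<in> ring_iso A B.
     \<forall>c. \<forall>x \<in> carrier A. h (c \<odot>\<^bsub>A\<^esub> x) = c \<odot>\<^bsub>B\<^esub> h x}"

definition isomorphic_algs :: "('k, 'a) module \<Rightarrow> ('k, 'b) module \<Rightarrow> bool" where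
  "isomorphic_algs A B \<longleftrightarrow> alg_iso A B \<noteq> {}"

definition smult_coset :: "('k, 'a) module \<Rightarrow> 'a set \<Rightarrow> 'k \<Rightarrow> 'a set \<Rightarrow> 'a set" where
  "smult_coset A I c X = (\<Union>x\<in>X. I +>\<^bsub>A\<^esub> (c \<odot>\<^bsub>A\<^esub> x))"

definition quot_alg :: "('k, 'a) module \<Rightarrow> 'a set \<Rightarrow> ('k, 'a set) module" where
  "quot_alg A I = ring.extend (A Quot I) (module.fields (smult_coset A I))"


section \<open>Jacobson radical and associated graded algebra\<close>

definition left_ideal :: "'a set \<Rightarrow> ('a, 'm) ring_scheme \<Rightarrow> bool" where
  "left_ideal L R \<longleftrightarrow> additive_subgroup L R \<and>
     (\<forall>a \<in> carrier R. \<forall>x \<in> L. a \<otimes>\<^bsub>R\<^esub> x \<in> L)"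

definition maximal_left_ideal :: "'a set \<Rightarrow> ('a, 'm) ring_scheme \<Rightarrow> bool" where
  "maximal_left_ideal L R \<longleftrightarrow> left_ideal L R \<and> L \<noteq> carrier R \<and>
     (\<forall>M. left_ideal M R \<longrightarrow> L \<subseteq> M \<longrightarrow> M = L \<or> M = carrier R)"

text \<open>The intersection with the carrier only matters for the zero ring.\<close>

definition jacobson_radical :: "('a, 'm) ring_scheme \<Rightarrow> 'a set" where
  "jacobson_radical R = carrier R \<inter> \<Inter>{L. maximal_left_ideal L R}"

fun ideal_power :: "('a, 'm) ring_scheme \<Rightarrow> 'a set \<Rightarrow> nat \<Rightarrow> 'a set" where
  "ideal_power R I 0 = carrier R"
| "ideal_power R I (Suc n) = ideal_prod R (ideal_power R I n) I"

text \<open>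
  \<open>gr_alg A I\<close> is the graded algebra \<open>\<Oplus>\<^sub>i I\<^sup>i / I\<^sup>i\<^sup>+\<^sup>1\<close> associated with the \<open>I\<close>-adic filtration.
  An element is the sequence of its homogeneous components; the \<open>i\<close>-th one is a coset of
  \<open>I\<^sup>i\<^sup>+\<^sup>1\<close> with a representative in \<open>I\<^sup>i\<close>, and almost all of them are the zero coset \<open>I\<^sup>i\<^sup>+\<^sup>1\<close>.
  The product of \<open>x + I\<^sup>i\<^sup>+\<^sup>1\<close> and \<open>y + I\<^sup>j\<^sup>+\<^sup>1\<close> is \<open>xy + I\<^sup>i\<^sup>+\<^sup>j\<^sup>+\<^sup>1\<close>.
\<close>

definition gr_component :: "('a, 'm) ring_scheme \<Rightarrow> 'a set \<Rightarrow> nat \<Rightarrow> 'a set set" where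
  "gr_component A I i = {ideal_power A I (Suc i) +>\<^bsub>A\<^esub> x | x. x \<in> ideal_power A I i}"

definition gr_prod ::
  "('a, 'm) ring_scheme \<Rightarrow> 'a set \<Rightarrow> nat \<Rightarrow> nat \<Rightarrow> 'a set \<Rightarrow> 'a set \<Rightarrow> 'a set" where
  "gr_prod A I i j X Y = (\<Union>x\<in>X. \<Union>y\<in>Y. ideal_power A I (Suc (i + j)) +>\<^bsub>A\<^esub> (x \<otimes>\<^bsub>A\<^esub> y))"

definition gr_alg :: "('k, 'a) module \<Rightarrow> 'a set \<Rightarrow> ('k, nat \<Rightarrow> 'a set) module" where
  "gr_alg A I =
    \<lparr>carrier = {f. (\<forall>i. f i \<in> gr_component A I i) \<and>
                   finite {i. f i \<noteq> ideal_power A I (Suc i)}},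
     monoid.mult = (\<lambda>f g n. finsum (A Quot ideal_power A I (Suc n))
                       (\<lambda>i. gr_prod A I i (n - i) (f i) (g (n - i))) {..n}),
     one = (\<lambda>i. if i = 0 then ideal_power A I 1 +>\<^bsub>A\<^esub> \<one>\<^bsub>A\<^esub> else ideal_power A I (Suc i)),
     ring.zero = (\<lambda>i. ideal_power A I (Suc i)),
     add = (\<lambda>f g i. f i <+>\<^bsub>A\<^esub> g i),
     module.smult = (\<lambda>c f i. smult_coset A (ideal_power A I (Suc i)) c (f i))\<rparr>"

definition tightly_graded :: "('k, 'a) module \<Rightarrow> bool" where
  "tightly_graded A \<longleftrightarrow> isomorphic_algs A (gr_alg A (jacobson_radical A))"


section \<open>Path algebras\<close>

text \<open>
  A path is given by its source, its list of arrows and its target. In a walk the head of each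
  arrow is the tail of the following one, so paths are written left to right.
\<close>

type_synonym ('v, 'e) qpath = "'v \<times> 'e list \<times> 'v"

definition qpaths :: "('v, 'e) pre_digraph \<Rightarrow> ('v, 'e) qpath set" where
  "qpaths Q = {(u, p, v). pre_digraph.awalk Q u p v}"

definition factorizations ::
  "('v, 'e) pre_digraph \<Rightarrow> ('v, 'e) qpath \<Rightarrow> (('v, 'e) qpath \<times> ('v, 'e) qpath) set" where
  "factorizations Q x = {((u, p, w), (w, q, v)) | u p w q v.
     (u, p, w) \<in> qpaths Q \<and> (w, q, v) \<in> qpaths Q \<and> x = (u, p @ q, v)}"

text \<open>
  Elements are finitely supported functions on paths. The unit is the sum of the trivial paths,
  which has finite support only for a quiver with finitely many vertices.
\<close>

definition path_algebra ::
  "('v, 'e) pre_digraph \<Rightarrow> ('k::field, ('v, 'e) qpath \<Rightarrow> 'k) module" where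
  "path_algebra Q =
    \<lparr>carrier = {f. finite {x. f x \<noteq> 0} \<and> {x. f x \<noteq> 0} \<subseteq> qpaths Q},
     monoid.mult = (\<lambda>f g x. \<Sum>(y, z)\<in>factorizations Q x. f y * g z),
     one = (\<lambda>x. if x \<in> {(v, [], v) | v. v \<in> verts Q} then 1 else 0),
     ring.zero = (\<lambda>x. 0),
     add = (\<lambda>f g x. f x + g x),
     module.smult = (\<lambda>c f x. c * f x)\<rparr>"

definition arrow_elem :: "('v, 'e) pre_digraph \<Rightarrow> 'e \<Rightarrow> ('v, 'e) qpath \<Rightarrow> 'k::field" where
  "arrow_elem Q e = (\<lambda>x. if x = (tail Q e, [e], head Q e) then 1 else 0)"


section \<open>The algebras \<open>B\<^sub>r\<close>\<close>

datatype arrow = C1 | C2 | C3 | D1 | D2 | D3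

definition B_quiver :: "(nat, arrow) pre_digraph" where
  "B_quiver =
    \<lparr>verts = {1, 2, 3},
     arcs = {C1, C2, C3, D1, D2, D3},
     tail = (\<lambda>e. case e of C1 \<Rightarrow> 1 | C2 \<Rightarrow> 2 | C3 \<Rightarrow> 3 | D1 \<Rightarrow> 2 | D2 \<Rightarrow> 3 | D3 \<Rightarrow> 1),
     head = (\<lambda>e. case e of C1 \<Rightarrow> 2 | C2 \<Rightarrow> 3 | C3 \<Rightarrow> 1 | D1 \<Rightarrow> 1 | D2 \<Rightarrow> 2 | D3 \<Rightarrow> 3)\<rparr>"

text \<open>A relation \<open>x = y\<close> is represented by the element \<open>x - y\<close>.\<close>

definition B_relations :: "nat \<Rightarrow> ((nat, arrow) qpath \<Rightarrow> 'k::field) set" where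
  "B_relations r =
    (let P = (path_algebra B_quiver :: ('k, (nat, arrow) qpath \<Rightarrow> 'k) module);
         c1 = arrow_elem B_quiver C1; c2 = arrow_elem B_quiver C2; c3 = arrow_elem B_quiver C3;
         d1 = arrow_elem B_quiver D1; d2 = arrow_elem B_quiver D2; d3 = arrow_elem B_quiver D3
     in {c1 \<otimes>\<^bsub>P\<^esub> c2, c2 \<otimes>\<^bsub>P\<^esub> c3, c3 \<otimes>\<^bsub>P\<^esub> c1,
         d1 \<otimes>\<^bsub>P\<^esub> d3, d3 \<otimes>\<^bsub>P\<^esub> d2, d2 \<otimes>\<^bsub>P\<^esub> d1,
         c1 \<otimes>\<^bsub>P\<^esub> d1 \<ominus>\<^bsub>P\<^esub> d3 \<otimes>\<^bsub>P\<^esub> c3,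
         d1 \<otimes>\<^bsub>P\<^esub> c1 \<ominus>\<^bsub>P\<^esub> (c2 \<otimes>\<^bsub>P\<^esub> d2) [^]\<^bsub>P\<^esub> r,
         c3 \<otimes>\<^bsub>P\<^esub> d3 \<ominus>\<^bsub>P\<^esub> (d2 \<otimes>\<^bsub>P\<^esub> c2) [^]\<^bsub>P\<^esub> r})"

definition B_alg :: "nat \<Rightarrow> ('k::field, ((nat, arrow) qpath \<Rightarrow> 'k) set) module" where
  "B_alg r = quot_alg (path_algebra B_quiver) (Idl\<^bsub>path_algebra B_quiver\<^esub> (B_relations r))"

end

theory Submission
  imports Defs
begin

text \<open>
  Give the arrows \<open>c\<^sub>2\<close>, \<open>d\<^sub>2\<close> weight 1 and the other four arrows weight \<open>r\<close>. Then every relation of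
  \<open>B\<^sub>r\<close> is homogeneous, and it says either that a path vanishes or that two paths are equal. Hence the
  nonzero classes of paths form a basis of \<open>B\<^sub>r\<close>. The decisive observation is that such a class is
  determined by its source, its weight and its target: the set \<open>basis r\<close> lists the triples that occur,
  and the product of two composable classes is the class with added weights if that triple is listed,
  and zero otherwise. Lemma \<open>path_kernel_eq_relation_ideal\<close> makes this precise: an element of the path
  algebra lies in the ideal generated by the relations if and only if, for each listed triple, its
  coefficients at the paths with this triple add up to zero. From there on \<open>B\<^sub>r\<close> is used only through
  the coordinates with respect to this basis (locale \<open>B_coordinates\<close>).

  No class has weight above \<open>2r\<close>, so the elements of positive weight form a nilpotent ideal \<open>J\<close>; the
  quotient is a product of three copies of the field, so \<open>J\<close> is the Jacobson radical.

  For \<open>r = 1\<close> the weight of a path is its length. The powers of \<open>J\<close> are then the steps of the weight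
  filtration, and mapping an element to the family of its homogeneous parts is an isomorphism onto the
  associated graded algebra.

  For \<open>r \<ge> 2\<close> the two algebras differ in the elements \<open>x\<close> of the radical with \<open>x \<cdot> rad = 0\<close>. In \<open>B\<^sub>r\<close>
  every class can be completed on the right to a class of weight \<open>2r\<close> (\<open>basis_dual\<close>), so such an \<open>x\<close>
  is a combination of \<open>c\<^sub>1d\<^sub>1\<close>, \<open>d\<^sub>1c\<^sub>1\<close> and \<open>c\<^sub>3d\<^sub>3\<close>, and in particular it lies in the square of the
  radical. In the graded algebra the class of \<open>d\<^sub>1\<close> in degree 1 annihilates everything of positive
  degree, because \<open>d\<^sub>1d\<^sub>3 = 0\<close> and \<open>d\<^sub>1c\<^sub>1 = (c\<^sub>2d\<^sub>2)\<^sup>r\<close> lies in \<open>J\<^sup>3\<close>, but no sum of products of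
  elements of positive degree has a component in degree 1. Elements of the radical are nilpotent, and
  a nilpotent element of the graded algebra has zero component in degree 0, so an isomorphism would
  transport the first property to the graded algebra.
\<close>

section \<open>The path algebra of a finite quiver is a ring\<close>

definition qpath_append :: "('v, 'e) qpath \<Rightarrow> ('v, 'e) qpath \<Rightarrow> ('v, 'e) qpath" where
  "qpath_append x y = (fst x, fst (snd x) @ fst (snd y), snd (snd y))"

lemma qpath_append_simp [simp]: "qpath_append (u, p, v) (w, q, x) = (u, p @ q, x)"
  by (simp add: qpath_append_def)

lemma factorizations_iff:
  "(y, z) \<in> factorizations Q x \<longleftrightarrow>
     y \<in> qpaths Q \<and> z \<in> qpaths Q \<and> snd (snd y) = fst z \<and> x = qpath_append y z"
  unfolding factorizations_def by (cases y; cases z) auto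

context wf_digraph
begin

lemma append_in_qpaths:
  "(u, p, v) \<in> qpaths G \<Longrightarrow> (v, q, w) \<in> qpaths G \<Longrightarrow> (u, p @ q, w) \<in> qpaths G"
  by (auto simp: qpaths_def awalk_appendI)

lemma qpath_append_in_qpaths:
  assumes "y \<in> qpaths G" "z \<in> qpaths G" "snd (snd y) = fst z"
  shows "qpath_append y z \<in> qpaths G"
  using assms by (cases y; cases z) (auto intro: append_in_qpaths)

lemma finite_factorizations: "finite (factorizations G x)"
proof -
  obtain u p v where x: "x = (u, p, v)" by (cases x)
  \<comment> \<open>A factorization is determined by the length of its first factor.\<close>
  let ?S = "\<lambda>k. ((u, take k p, awlast u (take k p)), (awlast u (take k p), drop k p, v))"
  have "factorizations G x \<subseteq> ?S ` {..length p}"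
  proof
    fix yz assume "yz \<in> factorizations G x"
    then obtain q w s where yz: "yz = ((u, q, w), (w, s, v))" "awalk u q w" "p = q @ s"
      unfolding factorizations_def qpaths_def x by auto
    have "awlast u q = w" using yz(2) by blast
    then have "yz = ?S (length q)" using yz by simp
    moreover have "length q \<in> {..length p}" using yz(3) by simp
    ultimately show "yz \<in> ?S ` {..length p}" by (rule image_eqI)
  qed
  then show ?thesis by (rule finite_subset) simp
qed

lemma factorizations_trivial:
  assumes "(u, p, v) \<in> qpaths G"
  shows "((u, [], u), (u, p, v)) \<in> factorizations G (u, p, v)"
    and "((u, p, v), (v, [], v)) \<in> factorizations G (u, p, v)"
  using assms awalk_hd_in_verts awalk_last_in_verts
  by (auto simp: factorizations_iff qpaths_def awalk_Nil_iff)

text \<open>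
  Both sides are the sum of \<open>f a * g b * h z\<close> over all ways of cutting \<open>x\<close> into three consecutive
  paths \<open>a\<close>, \<open>b\<close>, \<open>z\<close>.
\<close>

lemma sum_factorizations_assoc:
  fixes f g h :: "('a, 'b) qpath \<Rightarrow> 'k::field"
  shows "(\<Sum>(y, z)\<in>factorizations G x. (\<Sum>(a, b)\<in>factorizations G y. f a * g b) * h z)
       = (\<Sum>(a, t)\<in>factorizations G x. f a * (\<Sum>(b, z)\<in>factorizations G t. g b * h z))"
proof -
  let ?F = "factorizations G"
  have L: "(\<Sum>(y, z)\<in>?F x. (\<Sum>(a, b)\<in>?F y. f a * g b) * h z)
      = (\<Sum>((y, z), (a, b))\<in>Sigma (?F x) (\<lambda>(y, z). ?F y). f a * g b * h z)"
    by (subst sum.Sigma[symmetric])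
       (auto simp: finite_factorizations sum_distrib_right split_beta intro!: sum.cong)
  have R: "(\<Sum>(a, t)\<in>?F x. f a * (\<Sum>(b, z)\<in>?F t. g b * h z))
      = (\<Sum>((a, t), (b, z))\<in>Sigma (?F x) (\<lambda>(a, t). ?F t). f a * g b * h z)"
    by (subst sum.Sigma[symmetric])
       (auto simp: finite_factorizations sum_distrib_left split_beta mult.assoc intro!: sum.cong)
  show ?thesis unfolding L R
    by (rule sum.reindex_bij_witness[where
          i = "\<lambda>((a, t), (b, z)). ((qpath_append a b, z), (a, b))" and
          j = "\<lambda>((y, z), (a, b)). ((a, qpath_append b z), (b, z))"])
       (auto simp: factorizations_iff intro: append_in_qpaths)
qed

end

lemma path_algebra_simps:
  "carrier (path_algebra Q) = {f. finite {x. f x \<noteq> 0} \<and> {x. f x \<noteq> 0} \<subseteq> qpaths Q}"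
  "f \<otimes>\<^bsub>path_algebra Q\<^esub> g = (\<lambda>x. \<Sum>(y, z)\<in>factorizations Q x. f y * g z)"
  "\<one>\<^bsub>path_algebra Q\<^esub> = (\<lambda>x. if x \<in> {(v, [], v) | v. v \<in> verts Q} then 1 else 0)"
  "\<zero>\<^bsub>path_algebra Q\<^esub> = (\<lambda>x. 0)"
  "f \<oplus>\<^bsub>path_algebra Q\<^esub> g = (\<lambda>x. f x + g x)"
  "c \<odot>\<^bsub>path_algebra Q\<^esub> f = (\<lambda>x. c * f x)"
  by (simp_all add: path_algebra_def)

context fin_digraph
begin

lemma path_algebra_mult_closed:
  fixes f g :: "('a, 'b) qpath \<Rightarrow> 'k::field"
  assumes "f \<in> carrier (path_algebra G)" "g \<in> carrier (path_algebra G)"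
  shows "f \<otimes>\<^bsub>path_algebra G\<^esub> g \<in> carrier (path_algebra G)"
proof -
  let ?fg = "f \<otimes>\<^bsub>path_algebra G\<^esub> g"
  have witness: "\<exists>y z. f y \<noteq> 0 \<and> g z \<noteq> 0 \<and> (y, z) \<in> factorizations G x" if "?fg x \<noteq> 0" for x
  proof (rule ccontr)
    assume "\<not> ?thesis"
    then have "?fg x = 0"
      unfolding path_algebra_simps(2) by (intro sum.neutral) fastforce
    with that show False by simp
  qed
  have sub: "{x. ?fg x \<noteq> 0} \<subseteq> (\<lambda>(y, z). qpath_append y z) ` ({x. f x \<noteq> 0} \<times> {x. g x \<noteq> 0})"
  proof
    fix x assume "x \<in> {x. ?fg x \<noteq> 0}"
    then obtain y z where "f y \<noteq> 0" "g z \<noteq> 0" "x = qpath_append y z"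
      using witness[of x] unfolding mem_Collect_eq factorizations_iff by blast
    then show "x \<in> (\<lambda>(y, z). qpath_append y z) ` ({x. f x \<noteq> 0} \<times> {x. g x \<noteq> 0})"
      by (intro image_eqI[of _ _ "(y, z)"]) auto
  qed
  have "{x. ?fg x \<noteq> 0} \<subseteq> qpaths G"
  proof
    fix x assume "x \<in> {x. ?fg x \<noteq> 0}"
    then show "x \<in> qpaths G"
      using witness[of x] qpath_append_in_qpaths unfolding mem_Collect_eq factorizations_iff by blast
  qed
  moreover have "finite {x. ?fg x \<noteq> 0}"
    by (rule finite_subset[OF sub]) (use assms in \<open>auto simp: path_algebra_simps(1)\<close>)
  ultimately show ?thesis by (subst path_algebra_simps(1)) blast
qed

lemma path_algebra_one:
  fixes f :: "('a, 'b) qpath \<Rightarrow> 'k::field"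
  assumes f: "f \<in> carrier (path_algebra G)"
  shows "\<one>\<^bsub>path_algebra G\<^esub> \<otimes>\<^bsub>path_algebra G\<^esub> f = f"
    and "f \<otimes>\<^bsub>path_algebra G\<^esub> \<one>\<^bsub>path_algebra G\<^esub> = f"
proof -
  let ?one = "\<one>\<^bsub>path_algebra G\<^esub> :: ('a, 'b) qpath \<Rightarrow> 'k"
  have outside: "f x = 0" "factorizations G x = {}" if "x \<notin> qpaths G" for x
    using that f by (auto simp: path_algebra_simps(1) factorizations_iff intro: append_in_qpaths)
  show "?one \<otimes>\<^bsub>path_algebra G\<^esub> f = f"
  proof
    fix x :: "('a, 'b) qpath"
    obtain u p v where x: "x = (u, p, v)" by (cases x)
    show "(?one \<otimes>\<^bsub>path_algebra G\<^esub> f) x = f x"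
    proof (cases "x \<in> qpaths G")
      case True
      let ?i = "((u, [], u), x)"
      have i: "?i \<in> factorizations G x" using True factorizations_trivial x by blast
      have "(?one \<otimes>\<^bsub>path_algebra G\<^esub> f) x = (\<Sum>(y, z)\<in>{?i}. ?one y * f z)"
        unfolding path_algebra_simps(2)
        by (rule sum.mono_neutral_right)
           (use i in \<open>auto simp: finite_factorizations factorizations_iff path_algebra_simps x split: if_splits\<close>)
      also have "\<dots> = f x"
        using i by (auto simp: path_algebra_simps factorizations_iff qpaths_def awalk_Nil_iff)
      finally show ?thesis .
    qed (simp add: outside path_algebra_simps(2))
  qed
  show "f \<otimes>\<^bsub>path_algebra G\<^esub> ?one = f"
  proof
    fix x :: "('a, 'b) qpath"
    obtain u p v where x: "x = (u, p, v)" by (cases x)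
    show "(f \<otimes>\<^bsub>path_algebra G\<^esub> ?one) x = f x"
    proof (cases "x \<in> qpaths G")
      case True
      let ?i = "(x, (v, [], v))"
      have i: "?i \<in> factorizations G x" using True factorizations_trivial x by blast
      have "(f \<otimes>\<^bsub>path_algebra G\<^esub> ?one) x = (\<Sum>(y, z)\<in>{?i}. f y * ?one z)"
        unfolding path_algebra_simps(2)
        by (rule sum.mono_neutral_right)
           (use i in \<open>auto simp: finite_factorizations factorizations_iff path_algebra_simps x split: if_splits\<close>)
      also have "\<dots> = f x"
        using i by (auto simp: path_algebra_simps factorizations_iff qpaths_def awalk_Nil_iff)
      finally show ?thesis .
    qed (simp add: outside path_algebra_simps(2))
  qed
qed

lemma ring_path_algebra: "ring (path_algebra G :: ('k::field, ('a, 'b) qpath \<Rightarrow> 'k) module)"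
    (is "ring ?P")
proof (rule ringI)
  have zero: "\<zero>\<^bsub>?P\<^esub> \<in> carrier ?P" by (simp add: path_algebra_simps)
  have add: "f \<oplus>\<^bsub>?P\<^esub> g \<in> carrier ?P" if "f \<in> carrier ?P" "g \<in> carrier ?P" for f g
  proof -
    have "{x. f x + g x \<noteq> 0} \<subseteq> {x. f x \<noteq> 0} \<union> {x. g x \<noteq> 0}" by auto
    moreover have "finite ({x. f x \<noteq> 0} \<union> {x. g x \<noteq> 0})"
      "{x. f x \<noteq> 0} \<union> {x. g x \<noteq> 0} \<subseteq> qpaths G"
      using that by (simp_all add: path_algebra_simps)
    ultimately show ?thesis
      unfolding path_algebra_simps by (blast intro: finite_subset)
  qed
  have neg: "\<exists>g\<in>carrier ?P. g \<oplus>\<^bsub>?P\<^esub> f = \<zero>\<^bsub>?P\<^esub>" if "f \<in> carrier ?P" for f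
    using that by (intro bexI[of _ "\<lambda>x. - f x"]) (auto simp: path_algebra_simps)
  show "abelian_group ?P"
    by (rule abelian_groupI) (use zero add neg in \<open>simp_all add: path_algebra_simps(4,5) ac_simps\<close>)
  have one: "\<one>\<^bsub>?P\<^esub> \<in> carrier ?P"
    by (auto simp: path_algebra_simps qpaths_def awalk_Nil_iff)
  have assoc: "f \<otimes>\<^bsub>?P\<^esub> g \<otimes>\<^bsub>?P\<^esub> h = f \<otimes>\<^bsub>?P\<^esub> (g \<otimes>\<^bsub>?P\<^esub> h)" for f g h
    unfolding path_algebra_simps(2) by (intro ext sum_factorizations_assoc)
  show "monoid ?P"
    by (rule monoidI) (simp_all add: path_algebra_mult_closed one path_algebra_one assoc)
  show "(f \<oplus>\<^bsub>?P\<^esub> g) \<otimes>\<^bsub>?P\<^esub> h = f \<otimes>\<^bsub>?P\<^esub> h \<oplus>\<^bsub>?P\<^esub> g \<otimes>\<^bsub>?P\<^esub> h" for f g h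
    by (simp add: path_algebra_simps(2,5) distrib_right sum.distrib split_beta)
  show "h \<otimes>\<^bsub>?P\<^esub> (f \<oplus>\<^bsub>?P\<^esub> g) = h \<otimes>\<^bsub>?P\<^esub> f \<oplus>\<^bsub>?P\<^esub> h \<otimes>\<^bsub>?P\<^esub> g" for f g h
    by (simp add: path_algebra_simps(2,5) distrib_left sum.distrib split_beta)
qed

end

section \<open>Weights of paths and coordinates\<close>

text \<open>
  With these weights both sides of each relation have the same weight: it is \<open>2r\<close> for
  \<open>c\<^sub>1d\<^sub>1 = d\<^sub>3c\<^sub>3\<close>, for \<open>d\<^sub>1c\<^sub>1 = (c\<^sub>2d\<^sub>2)\<^sup>r\<close> and for \<open>c\<^sub>3d\<^sub>3 = (d\<^sub>2c\<^sub>2)\<^sup>r\<close>.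
\<close>

definition weight :: "nat \<Rightarrow> arrow list \<Rightarrow> nat" where
  "weight r p = sum_list (map (\<lambda>e. if e \<in> {C2, D2} then 1 else r) p)"

lemma weight_simps [simp]:
  "weight r [] = 0" "weight r (e # p) = (if e \<in> {C2, D2} then 1 else r) + weight r p"
  "weight r (p @ q) = weight r p + weight r q"
  by (auto simp: weight_def)

lemma length_le_weight: "r \<ge> 1 \<Longrightarrow> length p \<le> weight r p"
  by (induction p) auto

text \<open>
  A triple of natural numbers stands for source, weight and target, in this order.
\<close>

definition weighted_paths :: "nat \<Rightarrow> nat \<times> nat \<times> nat \<Rightarrow> (nat, arrow) qpath set" where
  "weighted_paths r b = {x \<in> qpaths B_quiver.
     fst x = fst b \<and> snd (snd x) = snd (snd b) \<and> weight r (fst (snd x)) = fst (snd b)}"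

lemma weighted_paths_iff:
  "x \<in> weighted_paths r (u, n, v) \<longleftrightarrow> (\<exists>p. x = (u, p, v) \<and> x \<in> qpaths B_quiver \<and> weight r p = n)"
  by (cases x) (auto simp: weighted_paths_def)

lemma B_quiver_simps [simp]:
  "verts B_quiver = {1, 2, 3}" "arcs B_quiver = UNIV"
  "tail B_quiver C1 = 1" "tail B_quiver C2 = 2" "tail B_quiver C3 = 3"
  "tail B_quiver D1 = 2" "tail B_quiver D2 = 3" "tail B_quiver D3 = 1"
  "head B_quiver C1 = 2" "head B_quiver C2 = 3" "head B_quiver C3 = 1"
  "head B_quiver D1 = 1" "head B_quiver D2 = 2" "head B_quiver D3 = 3"
proof -
  have "x \<in> {C1, C2, C3, D1, D2, D3}" for x by (cases x) auto
  then show "arcs B_quiver = UNIV" by (auto simp: B_quiver_def)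
qed (simp_all add: B_quiver_def)

lemma finite_arrows: "finite (UNIV :: arrow set)"
proof -
  have "x \<in> {C1, C2, C3, D1, D2, D3}" for x by (cases x) auto
  then show ?thesis by (rule_tac finite_subset[of _ "{C1, C2, C3, D1, D2, D3}"]) auto
qed

interpretation B_quiver: fin_digraph B_quiver
proof
  show "tail B_quiver e \<in> verts B_quiver" "head B_quiver e \<in> verts B_quiver" for e
    by (cases e; simp)+
  show "finite (arcs B_quiver)" by (simp add: finite_arrows)
qed simp

lemma qpaths_B_Nil: "(u, [], v) \<in> qpaths B_quiver \<longleftrightarrow> u = v \<and> u \<in> {1, 2, 3}"
  by (auto simp: qpaths_def B_quiver.awalk_Nil_iff)

lemma qpaths_B_snoc:
  "(u, p @ [e], v) \<in> qpaths B_quiver \<longleftrightarrow>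
     (u, p, tail B_quiver e) \<in> qpaths B_quiver \<and> v = head B_quiver e"
proof -
  have "head B_quiver e \<in> verts B_quiver" by (cases e) simp_all
  moreover have "e \<in> arcs B_quiver" by simp
  ultimately show ?thesis
    by (auto simp: qpaths_def B_quiver.awalk_append_iff B_quiver.awalk_Cons_iff
        B_quiver.awalk_Nil_iff simp del: B_quiver_simps)
qed

lemma qpaths_B_ends: "(u, p, v) \<in> qpaths B_quiver \<Longrightarrow> u \<in> {1, 2, 3} \<and> v \<in> {1, 2, 3}"
  using B_quiver.awalk_hd_in_verts B_quiver.awalk_last_in_verts by (fastforce simp: qpaths_def)

lemma finite_weighted_paths:
  assumes "r \<ge> 1"
  shows "finite (weighted_paths r b)"
proof -
  obtain u n v where b: "b = (u, n, v)" by (cases b)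
  have "weighted_paths r b \<subseteq> (\<lambda>p. (u, p, v)) ` {p. set p \<subseteq> UNIV \<and> length p \<le> n}"
    using length_le_weight[OF assms] by (auto simp: b weighted_paths_iff)
  then show ?thesis
    by (rule finite_subset) (simp only: finite_imageI finite_lists_length_le finite_arrows)
qed

definition weighted_coeff ::
    "nat \<Rightarrow> ((nat, arrow) qpath \<Rightarrow> 'k::field) \<Rightarrow> nat \<times> nat \<times> nat \<Rightarrow> 'k" where
  "weighted_coeff r f b = sum f (weighted_paths r b)"

text \<open>
  Cutting a path splits its weight, so the left-hand side is a sum over all pairs of composable paths
  with total weight \<open>n\<close>; on the right they are sorted by the cut vertex and the weight of the first
  path.
\<close>

lemma weighted_coeff_mult:
  fixes f g :: "(nat, arrow) qpath \<Rightarrow> 'k::field"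
  assumes r: "r \<ge> 1"
  shows "weighted_coeff r (f \<otimes>\<^bsub>path_algebra B_quiver\<^esub> g) (u, n, w)
    = (\<Sum>(m, v)\<in>{..n} \<times> {1, 2, 3}. weighted_coeff r f (u, m, v) * weighted_coeff r g (v, n - m, w))"
proof -
  let ?F = "factorizations B_quiver"
  let ?P = "weighted_paths r"
  note fin = finite_weighted_paths[OF r] B_quiver.finite_factorizations
  have L: "weighted_coeff r (f \<otimes>\<^bsub>path_algebra B_quiver\<^esub> g) (u, n, w)
      = (\<Sum>(x, (y, z))\<in>Sigma (?P (u, n, w)) ?F. f y * g z)"
    unfolding weighted_coeff_def path_algebra_simps(2)
    by (subst sum.Sigma[symmetric]) (auto simp: fin)
  have R: "(\<Sum>(m, v)\<in>{..n} \<times> {1, 2, 3}. weighted_coeff r f (u, m, v) * weighted_coeff r g (v, n - m, w))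
      = (\<Sum>((m, v), (y, z))\<in>Sigma ({..n} \<times> {1, 2, 3}) (\<lambda>(m, v). ?P (u, m, v) \<times> ?P (v, n - m, w)). f y * g z)"
    unfolding weighted_coeff_def
    by (subst sum.Sigma[symmetric])
       (auto simp: fin sum_product sum.cartesian_product intro!: sum.cong)
  show ?thesis unfolding L R
    by (rule sum.reindex_bij_witness[where
          i = "\<lambda>((m, v), (y, z)). (qpath_append y z, (y, z))" and
          j = "\<lambda>(x, (y, z)). ((weight r (fst (snd y)), fst z), (y, z))"])
       (auto simp: factorizations_iff weighted_paths_iff intro: B_quiver.append_in_qpaths,
        metis One_nat_def qpaths_B_ends insertE empty_iff)
qed

text \<open>
  The triples of the paths that do not vanish in \<open>B\<^sub>r\<close>. From 1 to 1 these are the trivial path and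
  \<open>c\<^sub>1d\<^sub>1 = d\<^sub>3c\<^sub>3\<close>; if exactly one end is 1, the single arrow of weight \<open>r\<close> between the two ends; between
  the vertices 2 and 3, the alternating words in \<open>c\<^sub>2\<close> and \<open>d\<^sub>2\<close> of length at most \<open>2r\<close>, which are closed
  exactly if their length is even.
\<close>

definition basis :: "nat \<Rightarrow> (nat \<times> nat \<times> nat) set" where
  "basis r = {(u, n, v). u \<in> {1, 2, 3} \<and> v \<in> {1, 2, 3} \<and>
     (if u = 1 \<and> v = 1 then n = 0 \<or> n = 2 * r
      else if u = 1 \<or> v = 1 then n = r
      else n \<le> 2 * r \<and> (even n \<longleftrightarrow> u = v))}"

text \<open>
  Necessary conditions on the triple of an arbitrary path. Entering or leaving vertex 1 costs weight
  \<open>r\<close>; a path between 2 and 3 whose weight has the wrong parity passes through 1, and therefore has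
  weight at least \<open>2r\<close>, and even more than \<open>2r\<close> if it is closed.
\<close>

definition admissible :: "nat \<Rightarrow> nat \<times> nat \<times> nat \<Rightarrow> bool" where
  "admissible r = (\<lambda>(u, n, v). u \<in> {1, 2, 3} \<and> v \<in> {1, 2, 3} \<and>
     (if u = 1 \<and> v = 1 then n = 0 \<or> 2 * r \<le> n
      else if u = 1 \<or> v = 1 then r \<le> n
      else if u = v then even n \<or> 2 * r < n
      else odd n \<or> 2 * r \<le> n))"

lemma admissible_path:
  assumes "(u, p, v) \<in> qpaths B_quiver"
  shows "admissible r (u, weight r p, v)"
  using assms
proof (induction p arbitrary: v rule: rev_induct)
  case Nil
  then show ?case by (auto simp: qpaths_B_Nil admissible_def)
next
  case (snoc e p)
  then have "admissible r (u, weight r p, tail B_quiver e)" and v: "v = head B_quiver e"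
    by (simp_all add: qpaths_B_snoc)
  then show ?case
    by (cases e) (auto simp: admissible_def split: if_splits)
qed

text \<open>
  The weight of a path with a triple in the basis leaves no room for a detour, so its subpaths have
  triples in the basis as well. This is why restricting to the basis is compatible with products.
\<close>

lemma basis_factor_closed:
  assumes "r \<ge> 1" "admissible r (u, m, v)" "admissible r (v, l, w)" "(u, m + l, w) \<in> basis r"
  shows "(u, m, v) \<in> basis r \<and> (v, l, w) \<in> basis r"
proof -
  have "u \<in> {1, 2, 3}" "v \<in> {1, 2, 3}" "w \<in> {1, 2, 3}"
    using assms(2,3) by (auto simp: admissible_def)
  then have "u = 1 \<or> u = 2 \<or> u = 3" "v = 1 \<or> v = 2 \<or> v = 3" "w = 1 \<or> w = 2 \<or> w = 3"
    by auto
  then show ?thesis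
    using assms by (elim disjE; hypsubst; auto simp: admissible_def basis_def)
qed

text \<open>
  This will turn out to be the coefficient of the class \<open>b\<close> in the image of \<open>f\<close> in \<open>B\<^sub>r\<close>.
\<close>

definition path_coord ::
    "nat \<Rightarrow> ((nat, arrow) qpath \<Rightarrow> 'k::field) \<Rightarrow> nat \<times> nat \<times> nat \<Rightarrow> 'k" where
  "path_coord r f b = (if b \<in> basis r then weighted_coeff r f b else 0)"

lemma path_coord_add: "path_coord r (\<lambda>x. f x + g x) b = path_coord r f b + path_coord r g b"
  by (simp add: path_coord_def weighted_coeff_def sum.distrib)

lemma path_coord_smult: "path_coord r (\<lambda>x. c * f x) b = c * path_coord r f b"
  by (simp add: path_coord_def weighted_coeff_def sum_distrib_left)

lemma weighted_coeff_eq_0: "\<not> admissible r (u, n, v) \<Longrightarrow> weighted_coeff r f (u, n, v) = 0"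
  unfolding weighted_coeff_def
  by (rule sum.neutral) (auto simp: weighted_paths_iff admissible_path)

lemma path_coord_mult:
  fixes f g :: "(nat, arrow) qpath \<Rightarrow> 'k::field"
  assumes r: "r \<ge> 1" and b: "(u, n, w) \<in> basis r"
  shows "path_coord r (f \<otimes>\<^bsub>path_algebra B_quiver\<^esub> g) (u, n, w)
    = (\<Sum>(m, v)\<in>{..n} \<times> {1, 2, 3}. path_coord r f (u, m, v) * path_coord r g (v, n - m, w))"
proof -
  have "weighted_coeff r f (u, m, v) * weighted_coeff r g (v, n - m, w)
      = path_coord r f (u, m, v) * path_coord r g (v, n - m, w)" if "m \<le> n" for m v
  \<comment> \<open>Unless both triples are admissible, both sides vanish for want of paths.\<close>
  proof (cases "admissible r (u, m, v) \<and> admissible r (v, n - m, w)")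
    case True
    then have "(u, m, v) \<in> basis r \<and> (v, n - m, w) \<in> basis r"
      using basis_factor_closed[OF r, of u m v "n - m" w] b that by simp
    then show ?thesis by (simp add: path_coord_def)
  qed (auto simp: path_coord_def weighted_coeff_eq_0)
  then show ?thesis
    unfolding path_coord_def[of r "f \<otimes>\<^bsub>path_algebra B_quiver\<^esub> g"] weighted_coeff_mult[OF r]
    using b by (auto intro!: sum.cong)
qed

lemma basis_weight_0_iff: "r \<ge> 1 \<Longrightarrow> (u, 0, v) \<in> basis r \<longleftrightarrow> u = v \<and> u \<in> {1, 2, 3}"
  by (auto simp: basis_def)

lemma path_coord_one:
  assumes r: "r \<ge> 1"
  shows "path_coord r (\<one>\<^bsub>path_algebra B_quiver\<^esub> :: (nat, arrow) qpath \<Rightarrow> 'k::field) (u, n, v)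
    = (if n = 0 \<and> u = v \<and> u \<in> {1, 2, 3} then 1 else 0)"
proof -
  let ?one = "\<one>\<^bsub>path_algebra B_quiver\<^esub> :: (nat, arrow) qpath \<Rightarrow> 'k"
  show ?thesis
  proof (cases "n = 0 \<and> u = v \<and> u \<in> {1, 2, 3}")
    case True
    have "length p \<le> 0" if "weight r p = 0" for p using length_le_weight[OF r, of p] that by simp
    with True have "weighted_paths r (u, n, v) = {(u, [], u)}"
      by (auto simp: weighted_paths_iff qpaths_B_Nil)
    then have "weighted_coeff r ?one (u, n, v) = 1"
      using True by (auto simp: weighted_coeff_def path_algebra_simps(3))
    with True show ?thesis using basis_weight_0_iff[OF r] by (simp add: path_coord_def)
  next
    case False
    then have "weighted_coeff r ?one (u, n, v) = 0"
      unfolding weighted_coeff_def path_algebra_simps(3)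
      by (intro sum.neutral) (auto simp: weighted_paths_iff)
    with False show ?thesis by (auto simp: path_coord_def)
  qed
qed

section \<open>Normal forms of paths modulo the relations\<close>

text \<open>
  The word in \<open>c\<^sub>2\<close> and \<open>d\<^sub>2\<close> of length \<open>n\<close> that starts at the vertex \<open>u\<close>, which is 2 or 3. It grows at
  its end, like the paths in the induction below.
\<close>

fun alternating :: "nat \<Rightarrow> nat \<Rightarrow> arrow list" where
  "alternating u 0 = []"
| "alternating u (Suc n) = alternating u n @ [if even n \<longleftrightarrow> u = 2 then C2 else D2]"

text \<open>
  A representative for each triple in the basis; the values elsewhere have no meaning.
\<close>

definition standard_path :: "nat \<times> nat \<times> nat \<Rightarrow> (nat, arrow) qpath" where
  "standard_path = (\<lambda>(u, n, v). (u,
     if u \<noteq> 1 \<and> v \<noteq> 1 then alternating u n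
     else if n = 0 then []
     else if u = 1 \<and> v = 1 then [C1, D1]
     else if v = 2 then [C1] else if v = 3 then [D3] else if u = 2 then [D1] else [C3], v))"

lemma alternating_in_qpaths:
  "u \<in> {2, 3} \<Longrightarrow> v \<in> {2, 3} \<Longrightarrow> (even n \<longleftrightarrow> u = v) \<Longrightarrow> (u, alternating u n, v) \<in> qpaths B_quiver"
proof (induction n arbitrary: v)
  case 0
  then show ?case by (auto simp: qpaths_B_Nil)
next
  case (Suc n)
  show ?case
  proof (cases "v = 2")
    case True
    then show ?thesis using Suc.prems Suc.IH[of 3] by (auto simp: qpaths_B_snoc)
  next
    case False
    then show ?thesis using Suc.prems Suc.IH[of 2] by (auto simp: qpaths_B_snoc)
  qed
qed

lemma arrow_in_qpaths: "(tail B_quiver e, [e], head B_quiver e) \<in> qpaths B_quiver"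
  using qpaths_B_snoc[of _ "[]" e] by (cases e) (auto simp: qpaths_B_Nil)

text \<open>
  A multiplicative evaluation of paths in a ring that respects the relations of \<open>B\<^sub>r\<close>. It will be the
  projection to the quotient by the ideal of relations; rewriting a path modulo the relations becomes a
  computation with ring elements.
\<close>

locale B_evaluation = ring R for R (structure) +
  fixes r :: nat and val :: "(nat, arrow) qpath \<Rightarrow> 'a" and a :: "arrow \<Rightarrow> 'a"
  assumes a_eq: "a e = val (tail B_quiver e, [e], head B_quiver e)"
    and r: "r \<ge> 1"
    and val_closed: "x \<in> qpaths B_quiver \<Longrightarrow> val x \<in> carrier R"
    and val_append: "(u, p, v) \<in> qpaths B_quiver \<Longrightarrow> (v, q, w) \<in> qpaths B_quiver \<Longrightarrow>
      val (u, p @ q, w) = val (u, p, v) \<otimes> val (v, q, w)"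
    and rel_cc: "a C1 \<otimes> a C2 = \<zero>"
      "a C2 \<otimes> a C3 = \<zero>" "a C3 \<otimes> a C1 = \<zero>"
    and rel_dd: "a D1 \<otimes> a D3 = \<zero>"
      "a D3 \<otimes> a D2 = \<zero>" "a D2 \<otimes> a D1 = \<zero>"
    and rel_1: "a C1 \<otimes> a D1 = a D3 \<otimes> a C3"
    and rel_2: "a D1 \<otimes> a C1 = (a C2 \<otimes> a D2) [^] r"
    and rel_3: "a C3 \<otimes> a D3 = (a D2 \<otimes> a C2) [^] r"
begin

lemma arrow_closed [simp]: "a e \<in> carrier R"
  unfolding a_eq by (rule val_closed[OF arrow_in_qpaths])

lemma val_arrow:
  "val (Suc 0, [C1], 2) = a C1" "val (2, [C2], 3) = a C2" "val (3, [C3], Suc 0) = a C3"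
  "val (2, [D1], Suc 0) = a D1" "val (3, [D2], 2) = a D2" "val (Suc 0, [D3], 3) = a D3"
  by (simp_all add: a_eq)

lemma val_snoc:
  assumes "(u, p, tail B_quiver e) \<in> qpaths B_quiver"
  shows "val (u, p @ [e], head B_quiver e)
    = val (u, p, tail B_quiver e) \<otimes> a e"
  using val_append[OF assms arrow_in_qpaths] by (simp only: a_eq)

lemma val_alternating_power:
  "k \<ge> 1 \<Longrightarrow> val (2, alternating 2 (2 * k), 2) = (a C2 \<otimes> a D2) [^] k"
  "k \<ge> 1 \<Longrightarrow> val (3, alternating 3 (2 * k), 3) = (a D2 \<otimes> a C2) [^] k"
proof -
  note q = alternating_in_qpaths
  have two: "val (2, alternating 2 (2 * Suc k), 2) =
      val (2, alternating 2 (2 * k), 2) \<otimes> (a C2 \<otimes> a D2)" for k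
    using val_snoc[of 2 "alternating 2 (2 * k)" C2] val_snoc[of 2 "alternating 2 (2 * k + 1)" D2]
      q[of 2 2 "2 * k"] q[of 2 3 "2 * k + 1"]
    by (simp add: m_assoc val_closed)
  have three: "val (3, alternating 3 (2 * Suc k), 3) =
      val (3, alternating 3 (2 * k), 3) \<otimes> (a D2 \<otimes> a C2)" for k
    using val_snoc[of 3 "alternating 3 (2 * k)" D2] val_snoc[of 3 "alternating 3 (2 * k + 1)" C2]
      q[of 3 3 "2 * k"] q[of 3 2 "2 * k + 1"]
    by (simp add: m_assoc val_closed)
  have one: "val (2, [C2, D2], 2) = a C2 \<otimes> a D2"
    "val (3, [D2, C2], 3) = a D2 \<otimes> a C2"
    using val_snoc[of 2 "[C2]" D2] val_snoc[of 3 "[D2]" C2] arrow_in_qpaths[of C2]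
      arrow_in_qpaths[of D2] by (simp_all add: val_arrow)
  show "k \<ge> 1 \<Longrightarrow> val (2, alternating 2 (2 * k), 2) = (a C2 \<otimes> a D2) [^] k"
  proof (induction k rule: nat_induct_at_least)
    case base
    then show ?case using one by (simp add: numeral_2_eq_2)
  next
    case (Suc k)
    then show ?case by (simp only: two nat_pow_Suc)
  qed
  show "k \<ge> 1 \<Longrightarrow> val (3, alternating 3 (2 * k), 3) = (a D2 \<otimes> a C2) [^] k"
  proof (induction k rule: nat_induct_at_least)
    case base
    then show ?case using one by (simp add: numeral_2_eq_2)
  next
    case (Suc k)
    then show ?case by (simp only: three nat_pow_Suc)
  qed
qed

lemma val_full_alternating:
  "val (2, alternating 2 (2 * r), 2) = a D1 \<otimes> a C1"
  "val (3, alternating 3 (2 * r), 3) = a C3 \<otimes> a D3"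
  using val_alternating_power[OF r] rel_2 rel_3 by simp_all

definition standard_val :: "nat \<times> nat \<times> nat \<Rightarrow> 'a" where
  "standard_val b = (if b \<in> basis r then val (standard_path b) else \<zero>)"

text \<open>
  An alternating word of full length equals \<open>d\<^sub>1c\<^sub>1\<close> or \<open>c\<^sub>3d\<^sub>3\<close>, and cannot be continued because
  \<open>c\<^sub>1c\<^sub>2 = d\<^sub>3d\<^sub>2 = 0\<close>.
\<close>

lemma alternating_step:
  assumes u: "u \<in> {2, 3}" and "n \<le> 2 * r"
  shows "(even n \<longleftrightarrow> u = 2) \<Longrightarrow>
      val (u, alternating u n, 2) \<otimes> a C2 = standard_val (u, n + 1, 3)"
    and "(even n \<longleftrightarrow> u = 3) \<Longrightarrow>
      val (u, alternating u n, 3) \<otimes> a D2 = standard_val (u, n + 1, 2)"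
proof -
  assume par: "even n \<longleftrightarrow> u = 2"
  show "val (u, alternating u n, 2) \<otimes> a C2 = standard_val (u, n + 1, 3)"
  proof (cases "n = 2 * r")
    case True
    then have "u = 2" using par by simp
    then show ?thesis
      using True rel_cc
      by (simp add: val_full_alternating m_assoc standard_val_def basis_def)
  next
    case False
    have "(u, n + 1, 3) \<in> basis r" using False assms par by (auto simp: basis_def)
    then show ?thesis
      using val_snoc[of u "alternating u n" C2] alternating_in_qpaths[of u 2 n] u par
      by (auto simp: standard_val_def standard_path_def)
  qed
next
  assume par: "even n \<longleftrightarrow> u = 3"
  show "val (u, alternating u n, 3) \<otimes> a D2 = standard_val (u, n + 1, 2)"
  proof (cases "n = 2 * r")
    case True
    then have "u = 3" using par by simp
    then show ?thesis
      using True rel_dd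
      by (simp add: val_full_alternating m_assoc standard_val_def basis_def)
  next
    case False
    have "(u, n + 1, 2) \<in> basis r" using False assms par by (auto simp: basis_def)
    then show ?thesis
      using val_snoc[of u "alternating u n" D2] alternating_in_qpaths[of u 3 n] u par
      by (auto simp: standard_val_def standard_path_def)
  qed
qed

text \<open>
  The last letter of the word is \<open>d\<^sub>2\<close> at vertex 2 and \<open>c\<^sub>2\<close> at vertex 3, and \<open>d\<^sub>2d\<^sub>1 = c\<^sub>2c\<^sub>3 = 0\<close>.
\<close>

lemma alternating_exit:
  assumes u: "u \<in> {2, 3}" and "n > 0"
  shows "(even n \<longleftrightarrow> u = 2) \<Longrightarrow> val (u, alternating u n, 2) \<otimes> a D1 = \<zero>"
    and "(even n \<longleftrightarrow> u = 3) \<Longrightarrow> val (u, alternating u n, 3) \<otimes> a C3 = \<zero>"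
proof -
  obtain m where n: "n = Suc m" using \<open>n > 0\<close> by (cases n) auto
  { assume par: "even n \<longleftrightarrow> u = 2"
    have "(u, alternating u m, 3) \<in> qpaths B_quiver"
      using alternating_in_qpaths[of u 3 m] u n par by auto
    then show "val (u, alternating u n, 2) \<otimes> a D1 = \<zero>"
      using val_snoc[of u "alternating u m" D2] rel_dd par n u
      by (auto simp: m_assoc val_closed) }
  { assume par: "even n \<longleftrightarrow> u = 3"
    have "(u, alternating u m, 2) \<in> qpaths B_quiver"
      using alternating_in_qpaths[of u 2 m] u n par by auto
    then show "val (u, alternating u n, 3) \<otimes> a C3 = \<zero>"
      using val_snoc[of u "alternating u m" C2] rel_cc par n u
      by (auto simp: m_assoc val_closed) }
qed

lemma val_trivial_left:
  assumes "(u, p, v) \<in> qpaths B_quiver"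
  shows "val (u, [], u) \<otimes> val (u, p, v) = val (u, p, v)"
  using val_append[of u "[]" u p v] assms qpaths_B_ends[OF assms] by (simp add: qpaths_B_Nil)

text \<open>
  Since \<open>r \<ge> 1\<close>, the element \<open>d\<^sub>1c\<^sub>1 = (c\<^sub>2d\<^sub>2)\<^sup>r\<close> begins with \<open>c\<^sub>2\<close>, and \<open>c\<^sub>1c\<^sub>2 = 0\<close>.
\<close>

lemma loop_square_zero:
  "a C1 \<otimes> (a D1 \<otimes> a C1) = \<zero>"
proof -
  obtain m where m: "r = Suc m" using r by (cases r) auto
  have "(a C2 \<otimes> a D2) [^] r
      = a C2 \<otimes> a D2 \<otimes> (a C2 \<otimes> a D2) [^] m"
    unfolding m by (rule nat_pow_Suc2) simp
  then show ?thesis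
    unfolding rel_2 using rel_cc by (simp add: m_assoc[symmetric])
qed

text \<open>
  The multiplication table of the standard paths with the arrows.
\<close>

lemma standard_step:
  assumes b: "(u, n, tail B_quiver e) \<in> basis r"
  shows "val (standard_path (u, n, tail B_quiver e)) \<otimes> a e
    = standard_val (u, n + (if e \<in> {C2, D2} then 1 else r), head B_quiver e)"
proof -
  have two: "val (1, [C1, D1], 1) = a C1 \<otimes> a D1"
    using val_snoc[of 1 "[C1]" D1] arrow_in_qpaths[of C1] by (simp add: a_eq)
  have unit: "val (tail B_quiver e, [], tail B_quiver e) \<otimes> a e
      = a e"
    unfolding a_eq by (rule val_trivial_left[OF arrow_in_qpaths])
  have u: "u = 1 \<or> u = 2 \<or> u = 3" using b by (auto simp: basis_def)
  show ?thesis
  proof (cases e)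
    case C1
    then show ?thesis
      using u b unit r rel_cc two loop_square_zero val_full_alternating
      by (auto simp: basis_def standard_val_def standard_path_def m_assoc val_arrow mult_2)
  next
    case D3
    then show ?thesis
      using u b unit r rel_dd two val_full_alternating
      by (auto simp: basis_def standard_val_def standard_path_def m_assoc val_arrow mult_2)
  next
    case C2
    then show ?thesis
      using u b rel_cc alternating_step(1)[of u n] r
      by (auto simp: basis_def standard_path_def val_arrow) (auto simp: basis_def standard_val_def)
  next
    case D2
    then show ?thesis
      using u b rel_dd alternating_step(2)[of u n] r
      by (auto simp: basis_def standard_path_def val_arrow) (auto simp: basis_def standard_val_def)
  next
    case D1
    then show ?thesis
      using u b unit r two alternating_exit(1)[of u n]
      by (cases "n = 0") (auto simp: basis_def standard_val_def standard_path_def val_arrow)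
  next
    case C3
    then show ?thesis
      using u b unit r two rel_1 alternating_exit(2)[of u n]
      by (cases "n = 0") (auto simp: basis_def standard_val_def standard_path_def val_arrow)
  qed
qed

text \<open>
  Appending arrows one at a time reduces each path to the standard path with the same triple, or to
  zero once the triple has left the basis: by \<open>basis_factor_closed\<close> it never returns.
\<close>

lemma val_eq_standard_val:
  assumes "(u, p, v) \<in> qpaths B_quiver"
  shows "val (u, p, v) = standard_val (u, weight r p, v)"
  using assms
proof (induction p arbitrary: v rule: rev_induct)
  case Nil
  then show ?case
    by (auto simp: qpaths_B_Nil standard_val_def basis_def standard_path_def)
next
  case (snoc e p)
  let ?t = "tail B_quiver e" and ?h = "head B_quiver e"
  let ?b = "(u, weight r p, ?t)"
  have p: "(u, p, ?t) \<in> qpaths B_quiver" and v: "v = ?h"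
    using snoc.prems by (simp_all add: qpaths_B_snoc)
  have eq: "val (u, p @ [e], v) = standard_val ?b \<otimes> a e"
    using val_snoc[OF p] snoc.IH[OF p] v by simp
  show ?case
  proof (cases "?b \<in> basis r")
    case True
    then show ?thesis using eq standard_step[OF True] v by (simp add: standard_val_def)
  next
    case False
    have "admissible r (?t, weight r [e], ?h)" by (rule admissible_path[OF arrow_in_qpaths])
    then have "(u, weight r (p @ [e]), v) \<notin> basis r"
      using basis_factor_closed[OF r admissible_path[OF p], of "weight r [e]" ?h] False v by auto
    then show ?thesis
      using eq False by (simp add: standard_val_def)
  qed
qed

end

section \<open>The ideal of relations is the kernel of the coordinates\<close>

definition path_elem :: "('v, 'e) qpath \<Rightarrow> ('v, 'e) qpath \<Rightarrow> 'k::field" where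
  "path_elem x = (\<lambda>y. if y = x then 1 else 0)"

lemma arrow_elem_eq_path_elem: "arrow_elem Q e = path_elem (tail Q e, [e], head Q e)"
  by (simp add: arrow_elem_def path_elem_def)

lemma path_elem_closed: "x \<in> qpaths Q \<Longrightarrow> path_elem x \<in> carrier (path_algebra Q)"
  by (simp add: path_algebra_simps path_elem_def)

lemma (in wf_digraph) path_elem_append:
  assumes "(u, p, v) \<in> qpaths G" "(v, q, w) \<in> qpaths G"
  shows "path_elem (u, p, v) \<otimes>\<^bsub>path_algebra G\<^esub> path_elem (v, q, w)
    = (path_elem (u, p @ q, w) :: _ \<Rightarrow> 'k::field)"
proof
  fix z :: "('a, 'b) qpath"
  let ?i = "((u, p, v), (v, q, w))"
  have "(path_elem (u, p, v) \<otimes>\<^bsub>path_algebra G\<^esub> path_elem (v, q, w)) z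
      = (\<Sum>i\<in>factorizations G z. if i = ?i then 1 else (0::'k))"
    unfolding path_algebra_simps(2) by (rule sum.cong) (auto simp: path_elem_def split: if_splits)
  also have "\<dots> = (if ?i \<in> factorizations G z then 1 else 0)"
    by (simp add: finite_factorizations)
  also have "?i \<in> factorizations G z \<longleftrightarrow> z = (u, p @ q, w)"
    using assms by (auto simp: factorizations_iff)
  finally show "(path_elem (u, p, v) \<otimes>\<^bsub>path_algebra G\<^esub> path_elem (v, q, w)) z
      = (path_elem (u, p @ q, w) z :: 'k)" by (simp add: path_elem_def)
qed

lemma (in fin_digraph) path_algebra_minus:
  fixes f g :: "('a, 'b) qpath \<Rightarrow> 'k::field"
  assumes "f \<in> carrier (path_algebra G)" "g \<in> carrier (path_algebra G)"
  shows "f \<ominus>\<^bsub>path_algebra G\<^esub> g = (\<lambda>x. f x - g x)"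
proof -
  interpret ring "path_algebra G :: ('k, ('a, 'b) qpath \<Rightarrow> 'k) module" by (rule ring_path_algebra)
  have "\<ominus>\<^bsub>path_algebra G\<^esub> g = (\<lambda>x. - g x)"
    by (rule minus_equality) (use assms in \<open>auto simp: path_algebra_simps\<close>)
  then show ?thesis by (simp add: a_minus_def path_algebra_simps)
qed

lemma (in fin_digraph) path_ideal_smult:
  fixes f :: "('a, 'b) qpath \<Rightarrow> 'k::field"
  assumes I: "ideal I (path_algebra G)" and f: "f \<in> I"
  shows "c \<odot>\<^bsub>path_algebra G\<^esub> f \<in> I"
proof -
  interpret ideal I "path_algebra G" by fact
  \<comment> \<open>Scaling by c is multiplication by the scalar multiple of the unit by c.\<close>
  have "c \<odot>\<^bsub>path_algebra G\<^esub> \<one>\<^bsub>path_algebra G\<^esub> \<in> carrier (path_algebra G)"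
    using one_closed by (auto simp: path_algebra_simps)
  then have "(c \<odot>\<^bsub>path_algebra G\<^esub> \<one>\<^bsub>path_algebra G\<^esub>) \<otimes>\<^bsub>path_algebra G\<^esub> f \<in> I"
    using f by (rule I_l_closed[rotated])
  also have "(c \<odot>\<^bsub>path_algebra G\<^esub> \<one>\<^bsub>path_algebra G\<^esub>) \<otimes>\<^bsub>path_algebra G\<^esub> f
      = c \<odot>\<^bsub>path_algebra G\<^esub> (\<one>\<^bsub>path_algebra G\<^esub> \<otimes>\<^bsub>path_algebra G\<^esub> f)"
    unfolding path_algebra_simps(2,6) by (auto simp: sum_distrib_left mult.assoc split_beta)
  finally show ?thesis using f by simp
qed

abbreviation B_paths :: "('k::field, (nat, arrow) qpath \<Rightarrow> 'k) module" where
  "B_paths \<equiv> path_algebra B_quiver"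

interpretation B_paths: ring "B_paths :: ('k::field, (nat, arrow) qpath \<Rightarrow> 'k) module"
  by (rule B_quiver.ring_path_algebra)

lemma path_coord_path_elem:
  assumes r: "r \<ge> 1" and x: "(u, p, v) \<in> qpaths B_quiver"
  shows "path_coord r (path_elem (u, p, v)) b
    = (if b \<in> basis r \<and> b = (u, weight r p, v) then 1 else (0::'k::field))"
proof -
  have "weighted_coeff r (path_elem (u, p, v)) b
      = (if (u, p, v) \<in> weighted_paths r b then 1 else (0::'k))"
    unfolding weighted_coeff_def path_elem_def by (simp add: finite_weighted_paths[OF r])
  moreover have "(u, p, v) \<in> weighted_paths r b \<longleftrightarrow> b = (u, weight r p, v)"
    using x by (cases b) (auto simp: weighted_paths_iff)
  ultimately show ?thesis by (cases "b = (u, weight r p, v)") (auto simp: path_coord_def)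
qed

lemma path_elem_power:
  assumes p: "(u, p, u) \<in> qpaths B_quiver" and "k \<ge> 1"
  shows "(u, concat (replicate k p), u) \<in> qpaths B_quiver \<and>
    path_elem (u, p, u) [^]\<^bsub>B_paths\<^esub> k = (path_elem (u, concat (replicate k p), u) :: _ \<Rightarrow> 'k::field)"
  using \<open>k \<ge> 1\<close>
proof (induction k rule: nat_induct_at_least)
  case base
  have "(path_elem (u, p, u) :: _ \<Rightarrow> 'k) \<in> carrier B_paths" by (rule path_elem_closed[OF p])
  then show ?case using p by simp
next
  case (Suc k)
  have "concat (replicate (Suc k) p) = concat (replicate k p) @ p"
    by (induction k) auto
  then show ?case
    using Suc.IH p
    by (auto simp del: replicate_Suc intro: B_quiver.append_in_qpaths B_quiver.path_elem_append)
qed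

lemma weight_concat_replicate: "weight r (concat (replicate k p)) = k * weight r p"
  by (induction k) auto

lemma B_relations_eq:
  assumes r: "r \<ge> 1"
  shows "(B_relations r :: ((nat, arrow) qpath \<Rightarrow> 'k::field) set) =
    {path_elem (1, [C1, C2], 3), path_elem (2, [C2, C3], 1), path_elem (3, [C3, C1], 2),
     path_elem (2, [D1, D3], 3), path_elem (1, [D3, D2], 2), path_elem (3, [D2, D1], 1),
     path_elem (1, [C1, D1], 1) \<ominus>\<^bsub>B_paths\<^esub> path_elem (1, [D3, C3], 1),
     path_elem (2, [D1, C1], 2) \<ominus>\<^bsub>B_paths\<^esub> path_elem (2, concat (replicate r [C2, D2]), 2),
     path_elem (3, [C3, D3], 3) \<ominus>\<^bsub>B_paths\<^esub> path_elem (3, concat (replicate r [D2, C2]), 3)}"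
proof -
  have mult: "arrow_elem B_quiver e \<otimes>\<^bsub>B_paths\<^esub> arrow_elem B_quiver e'
      = (path_elem (tail B_quiver e, [e, e'], head B_quiver e') :: _ \<Rightarrow> 'k)"
    if "head B_quiver e = tail B_quiver e'" for e e'
    using B_quiver.path_elem_append[OF arrow_in_qpaths[of e], of "[e']" "head B_quiver e'"]
      arrow_in_qpaths[of e'] that
    by (simp add: arrow_elem_eq_path_elem)
  have "(2, [C2, D2], 2) \<in> qpaths B_quiver" "(3, [D2, C2], 3) \<in> qpaths B_quiver"
    using alternating_in_qpaths[of 2 2 2] alternating_in_qpaths[of 3 3 2]
    by (simp_all add: numeral_2_eq_2)
  then show ?thesis
    unfolding B_relations_def Let_def
    by (simp add: mult path_elem_power[OF _ r])
qed

definition path_kernel :: "nat \<Rightarrow> ((nat, arrow) qpath \<Rightarrow> 'k::field) set" where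
  "path_kernel r = {f \<in> carrier B_paths. \<forall>b. path_coord r f b = 0}"

lemma ideal_path_kernel:
  assumes r: "r \<ge> 1"
  shows "ideal (path_kernel r :: ((nat, arrow) qpath \<Rightarrow> 'k::field) set) B_paths"
proof (rule idealI)
  have zero: "path_coord r (\<lambda>x. 0 :: 'k) b = 0" for b
    using path_coord_smult[of r 0 "\<lambda>x. 0 :: 'k" b] by simp
  have mult: "path_coord r (f \<otimes>\<^bsub>B_paths\<^esub> g) b = (0::'k)"
    if "(\<forall>b. path_coord r f b = 0) \<or> (\<forall>b. path_coord r g b = 0)" for f g b
  proof (cases "b \<in> basis r")
    case True
    with that show ?thesis
      by (cases b) (auto simp: path_coord_mult[OF r] intro!: sum.neutral)
  qed (simp add: path_coord_def)
  show "subgroup (path_kernel r :: ((nat, arrow) qpath \<Rightarrow> 'k) set) (add_monoid B_paths)"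
  proof (rule B_paths.add.subgroupI)
    show "path_kernel r \<subseteq> carrier (B_paths :: ('k, (nat, arrow) qpath \<Rightarrow> 'k) module)"
      by (auto simp: path_kernel_def)
    show "path_kernel r \<noteq> ({} :: ((nat, arrow) qpath \<Rightarrow> 'k) set)"
      using zero by (auto simp: path_kernel_def path_algebra_simps(1) intro!: exI[of _ "\<lambda>x. 0"])
    fix f g :: "(nat, arrow) qpath \<Rightarrow> 'k"
    assume f: "f \<in> path_kernel r"
    have "\<ominus>\<^bsub>B_paths\<^esub> f = (\<lambda>x. - 1 * f x)"
    proof -
      have carr: "f \<in> carrier B_paths" using f by (simp add: path_kernel_def)
      then have "\<ominus>\<^bsub>B_paths\<^esub> f = \<zero>\<^bsub>B_paths\<^esub> \<ominus>\<^bsub>B_paths\<^esub> f"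
        by (simp add: B_paths.minus_eq)
      also have "\<dots> = (\<lambda>x. - 1 * f x)"
        unfolding B_quiver.path_algebra_minus[OF B_paths.zero_closed carr]
        by (simp add: path_algebra_simps(4))
      finally show ?thesis .
    qed
    moreover have "\<ominus>\<^bsub>B_paths\<^esub> f \<in> carrier B_paths"
      using f by (simp add: path_kernel_def)
    ultimately show "\<ominus>\<^bsub>B_paths\<^esub> f \<in> path_kernel r"
      using f path_coord_smult[of r "- 1" f] by (simp add: path_kernel_def)
    assume g: "g \<in> path_kernel r"
    have "f \<oplus>\<^bsub>B_paths\<^esub> g \<in> carrier B_paths"
      using f g by (simp add: path_kernel_def)
    then show "f \<oplus>\<^bsub>B_paths\<^esub> g \<in> path_kernel r"
      using f g by (simp add: path_kernel_def path_algebra_simps(5) path_coord_add)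
  qed
  show "g \<otimes>\<^bsub>B_paths\<^esub> f \<in> path_kernel r" "f \<otimes>\<^bsub>B_paths\<^esub> g \<in> path_kernel r"
    if "f \<in> path_kernel r" "g \<in> carrier B_paths" for f g :: "(nat, arrow) qpath \<Rightarrow> 'k"
    using that mult by (auto simp: path_kernel_def)
qed (rule B_quiver.ring_path_algebra)

lemma qpaths_B_two:
  "head B_quiver e = tail B_quiver e' \<Longrightarrow>
     (tail B_quiver e, [e, e'], head B_quiver e') \<in> qpaths B_quiver"
  using qpaths_B_snoc[of "tail B_quiver e" "[e]" e'] arrow_in_qpaths[of e] by simp

lemma qpaths_in_relations:
  "(Suc 0, [C1, C2], 3) \<in> qpaths B_quiver" "(2, [C2, C3], Suc 0) \<in> qpaths B_quiver"
  "(3, [C3, C1], 2) \<in> qpaths B_quiver" "(2, [D1, D3], 3) \<in> qpaths B_quiver"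
  "(Suc 0, [D3, D2], 2) \<in> qpaths B_quiver" "(3, [D2, D1], Suc 0) \<in> qpaths B_quiver"
  "(Suc 0, [C1, D1], Suc 0) \<in> qpaths B_quiver" "(Suc 0, [D3, C3], Suc 0) \<in> qpaths B_quiver"
  "(2, [D1, C1], 2) \<in> qpaths B_quiver" "(3, [C3, D3], 3) \<in> qpaths B_quiver"
  "(2, [C2, D2], 2) \<in> qpaths B_quiver" "(3, [D2, C2], 3) \<in> qpaths B_quiver"
  using qpaths_B_two[of C1 C2] qpaths_B_two[of C2 C3] qpaths_B_two[of C3 C1]
    qpaths_B_two[of D1 D3] qpaths_B_two[of D3 D2] qpaths_B_two[of D2 D1]
    qpaths_B_two[of C1 D1] qpaths_B_two[of D3 C3] qpaths_B_two[of D1 C1]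
    qpaths_B_two[of C3 D3] qpaths_B_two[of C2 D2] qpaths_B_two[of D2 C2]
  by simp_all

lemma qpaths_powers:
  assumes "r \<ge> 1"
  shows "(2, concat (replicate r [C2, D2]), 2) \<in> qpaths B_quiver"
    "(3, concat (replicate r [D2, C2]), 3) \<in> qpaths B_quiver"
  using path_elem_power[OF qpaths_in_relations(11) assms]
    path_elem_power[OF qpaths_in_relations(12) assms] by auto

lemma B_relations_carrier:
  "r \<ge> 1 \<Longrightarrow> (B_relations r :: ((nat, arrow) qpath \<Rightarrow> 'k::field) set) \<subseteq> carrier B_paths"
  by (auto simp: B_relations_eq path_elem_closed qpaths_in_relations qpaths_powers)

lemma path_coord_minus: "path_coord r (\<lambda>x. f x - g x) b = path_coord r f b - path_coord r g b"
  using path_coord_add[of r f "\<lambda>x. - 1 * g x" b] path_coord_smult[of r "- 1" g b] by simp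

lemma B_relations_in_kernel:
  assumes r: "r \<ge> 1"
  shows "(B_relations r :: ((nat, arrow) qpath \<Rightarrow> 'k::field) set) \<subseteq> path_kernel r"
proof -
  note q = qpaths_in_relations qpaths_powers[OF r]
  have zero: "path_elem (u, p, v) \<in> (path_kernel r :: ((nat, arrow) qpath \<Rightarrow> 'k) set)"
    if "(u, p, v) \<in> qpaths B_quiver" "(u, weight r p, v) \<notin> basis r" for u p v
    using that by (auto simp: path_kernel_def path_elem_closed path_coord_path_elem[OF r])
  have eq: "path_elem (u, p, v) \<ominus>\<^bsub>B_paths\<^esub> path_elem (u, q, v) \<in> (path_kernel r :: ((nat, arrow) qpath \<Rightarrow> 'k) set)"
    if "(u, p, v) \<in> qpaths B_quiver" "(u, q, v) \<in> qpaths B_quiver" "weight r p = weight r q" for u p q v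
  proof -
    have c: "(path_elem (u, p, v) :: _ \<Rightarrow> 'k) \<in> carrier B_paths"
      "(path_elem (u, q, v) :: _ \<Rightarrow> 'k) \<in> carrier B_paths"
      using that(1,2) by (simp_all add: path_elem_closed)
    show ?thesis
      using B_paths.minus_closed[OF c] that
      unfolding path_kernel_def B_quiver.path_algebra_minus[OF c]
      by (simp add: path_coord_minus path_coord_path_elem[OF r])
  qed
  show ?thesis
    unfolding B_relations_eq[OF r] insert_subset
    using r by (intro conjI empty_subsetI zero eq)
      (simp_all add: q basis_def weight_concat_replicate)
qed

lemma B_evaluation_quotient:
  assumes r: "r \<ge> 1"
  defines "I \<equiv> Idl\<^bsub>B_paths\<^esub> (B_relations r :: ((nat, arrow) qpath \<Rightarrow> 'k::field) set)"
  shows "B_evaluation (B_paths Quot I) r (\<lambda>x. I +>\<^bsub>B_paths\<^esub> path_elem x)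
    (\<lambda>e. I +>\<^bsub>B_paths\<^esub> path_elem (tail B_quiver e, [e], head B_quiver e))"
proof -
  let ?P = "B_paths :: ('k, (nat, arrow) qpath \<Rightarrow> 'k) module"
  let ?h = "(+>\<^bsub>?P\<^esub>) I"
  interpret ideal I ?P
    unfolding I_def by (rule B_paths.genideal_ideal[OF B_relations_carrier[OF r]])
  interpret Q: ring "?P Quot I" by (rule quotient_is_ring)
  interpret h: ring_hom_ring ?P "?P Quot I" ?h by (rule rcos_ring_hom_ring)
  note q = qpaths_in_relations qpaths_powers[OF r]
  have rel: "B_relations r \<subseteq> I" unfolding I_def by (rule B_paths.genideal_self[OF B_relations_carrier[OF r]])
  have app: "?h (path_elem (u, p, v)) \<otimes>\<^bsub>?P Quot I\<^esub> ?h (path_elem (v, q, w)) = ?h (path_elem (u, p @ q, w))"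
    if "(u, p, v) \<in> qpaths B_quiver" "(v, q, w) \<in> qpaths B_quiver" for u p v q w
    using h.hom_mult[OF path_elem_closed[OF that(1)] path_elem_closed[OF that(2)]]
    by (simp add: B_quiver.path_elem_append[OF that])
  have two: "?h (path_elem (tail B_quiver e, [e], head B_quiver e)) \<otimes>\<^bsub>?P Quot I\<^esub>
      ?h (path_elem (tail B_quiver e', [e'], head B_quiver e'))
      = ?h (path_elem (tail B_quiver e, [e, e'], head B_quiver e'))"
    if "head B_quiver e = tail B_quiver e'" for e e'
    using app[OF arrow_in_qpaths[of e], of "[e']" "head B_quiver e'"] arrow_in_qpaths[of e'] that by simp
  have Q0: "\<zero>\<^bsub>?P Quot I\<^esub> = I" by (simp only: FactRing_def ring.simps)
  have zero: "?h f = \<zero>\<^bsub>?P Quot I\<^esub>" if "f \<in> B_relations r" for f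
    unfolding Q0 by (rule a_rcos_const[OF subsetD[OF rel that]])
  have eq: "?h f = ?h g" if "f \<ominus>\<^bsub>?P\<^esub> g \<in> B_relations r" "f \<in> carrier ?P" "g \<in> carrier ?P" for f g
    using B_paths.quotient_eq_iff_same_a_r_cos[OF ideal_axioms that(2,3)] that(1) rel by auto
  have pow: "?h (path_elem (u, p, u)) [^]\<^bsub>?P Quot I\<^esub> r = ?h (path_elem (u, concat (replicate r p), u))"
    if "(u, p, u) \<in> qpaths B_quiver" for u p
  proof -
    have "path_elem (u, p, u) [^]\<^bsub>?P\<^esub> r = (path_elem (u, concat (replicate r p), u) :: _ \<Rightarrow> 'k)"
      using path_elem_power[OF that r] by blast
    then show ?thesis
      using h.hom_nat_pow[OF path_elem_closed[OF that], of r] by simp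
  qed
  show ?thesis
  proof (rule B_evaluation.intro[OF quotient_is_ring], unfold_locales)
    show "?h (path_elem x) \<in> carrier (?P Quot I)" if "x \<in> qpaths B_quiver" for x
      using h.hom_closed path_elem_closed[OF that] .
    let ?a = "\<lambda>e. ?h (path_elem (tail B_quiver e, [e], head B_quiver e))"
    note two = two[of C1 C2] two[of C2 C3] two[of C3 C1] two[of D1 D3] two[of D3 D2] two[of D2 D1]
      two[of C1 D1] two[of D3 C3] two[of D1 C1] two[of C3 D3] two[of C2 D2] two[of D2 C2]
    show "?a C1 \<otimes>\<^bsub>?P Quot I\<^esub> ?a C2 = \<zero>\<^bsub>?P Quot I\<^esub>"
      "?a C2 \<otimes>\<^bsub>?P Quot I\<^esub> ?a C3 = \<zero>\<^bsub>?P Quot I\<^esub>"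
      "?a C3 \<otimes>\<^bsub>?P Quot I\<^esub> ?a C1 = \<zero>\<^bsub>?P Quot I\<^esub>"
      "?a D1 \<otimes>\<^bsub>?P Quot I\<^esub> ?a D3 = \<zero>\<^bsub>?P Quot I\<^esub>"
      "?a D3 \<otimes>\<^bsub>?P Quot I\<^esub> ?a D2 = \<zero>\<^bsub>?P Quot I\<^esub>"
      "?a D2 \<otimes>\<^bsub>?P Quot I\<^esub> ?a D1 = \<zero>\<^bsub>?P Quot I\<^esub>"
      using two by (simp_all del: One_nat_def) (rule zero; simp add: B_relations_eq[OF r])+
    show "?a C1 \<otimes>\<^bsub>?P Quot I\<^esub> ?a D1 = ?a D3 \<otimes>\<^bsub>?P Quot I\<^esub> ?a C3"
      using two by (simp del: One_nat_def) (rule eq; simp add: B_relations_eq[OF r] path_elem_closed q)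
    show "?a D1 \<otimes>\<^bsub>?P Quot I\<^esub> ?a C1 = (?a C2 \<otimes>\<^bsub>?P Quot I\<^esub> ?a D2) [^]\<^bsub>?P Quot I\<^esub> r"
      "?a C3 \<otimes>\<^bsub>?P Quot I\<^esub> ?a D3 = (?a D2 \<otimes>\<^bsub>?P Quot I\<^esub> ?a C2) [^]\<^bsub>?P Quot I\<^esub> r"
      using two pow[OF q(11)] pow[OF q(12)]
      by (simp_all del: One_nat_def) (rule eq; simp add: B_relations_eq[OF r] path_elem_closed q)+
  qed (use r app in simp_all)
qed

text \<open>
  The normal form of a path, read in the quotient by the ideal of relations.
\<close>

lemma relation_ideal_paths:
  assumes r: "r \<ge> 1"
  defines "I \<equiv> Idl\<^bsub>B_paths\<^esub> (B_relations r :: ((nat, arrow) qpath \<Rightarrow> 'k::field) set)"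
  assumes x: "(u, p, v) \<in> qpaths B_quiver"
  shows "(u, weight r p, v) \<notin> basis r \<Longrightarrow> path_elem (u, p, v) \<in> I"
    and "(u, q, v) \<in> qpaths B_quiver \<Longrightarrow> weight r p = weight r q \<Longrightarrow>
      path_elem (u, p, v) \<ominus>\<^bsub>B_paths\<^esub> path_elem (u, q, v) \<in> I"
proof -
  let ?P = "B_paths :: ('k, (nat, arrow) qpath \<Rightarrow> 'k) module"
  interpret I: ideal I ?P
    unfolding I_def by (rule B_paths.genideal_ideal[OF B_relations_carrier[OF r]])
  interpret E: B_evaluation "?P Quot I" r "\<lambda>x. I +>\<^bsub>?P\<^esub> path_elem x"
    "\<lambda>e. I +>\<^bsub>?P\<^esub> path_elem (tail B_quiver e, [e], head B_quiver e)"
    unfolding I_def by (rule B_evaluation_quotient[OF r])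
  have zero: "\<zero>\<^bsub>?P Quot I\<^esub> = I" by (simp only: FactRing_def ring.simps)
  { assume "(u, weight r p, v) \<notin> basis r"
    then have "I +>\<^bsub>?P\<^esub> path_elem (u, p, v) = I"
      using E.val_eq_standard_val[OF x] unfolding E.standard_val_def zero by (simp only: if_False)
    then show "path_elem (u, p, v) \<in> I"
      using I.a_rcos_self[OF path_elem_closed[OF x]] by (simp only:) }
  { assume y: "(u, q, v) \<in> qpaths B_quiver" and w: "weight r p = weight r q"
    have "I +>\<^bsub>?P\<^esub> path_elem (u, p, v) = I +>\<^bsub>?P\<^esub> path_elem (u, q, v)"
      using E.val_eq_standard_val[OF x] E.val_eq_standard_val[OF y] w by (simp only:)
    then show "path_elem (u, p, v) \<ominus>\<^bsub>?P\<^esub> path_elem (u, q, v) \<in> I"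
      using B_paths.quotient_eq_iff_same_a_r_cos[OF I.ideal_axioms
          path_elem_closed[OF x] path_elem_closed[OF y]] by blast }
qed

text \<open>
  If the triple of \<open>x\<close> is not in the basis, the path \<open>x\<close> itself lies in the ideal. Otherwise the
  coefficients of \<open>f\<close> at the paths with this triple add up to zero, so a second such path occurs in
  \<open>f\<close>, and the difference of the two lies in the ideal.
\<close>

lemma relation_ideal_support_reduction:
  fixes f :: "(nat, arrow) qpath \<Rightarrow> 'k::field"
  assumes r: "r \<ge> 1" and f: "f \<in> path_kernel r" and fx: "f x \<noteq> 0"
  shows "\<exists>d \<in> Idl\<^bsub>B_paths\<^esub> (B_relations r :: (_ \<Rightarrow> 'k) set). d x = 1 \<and> (\<forall>z. d z \<noteq> 0 \<longrightarrow> f z \<noteq> 0)"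
proof -
  obtain u p v where x: "x = (u, p, v)" by (cases x)
  let ?b = "(u, weight r p, v)"
  have q: "(u, p, v) \<in> qpaths B_quiver"
    using f fx x by (auto simp: path_kernel_def path_algebra_simps(1))
  show ?thesis
  proof (cases "?b \<in> basis r")
    case False
    show ?thesis
      by (rule bexI[OF _ relation_ideal_paths(1)[OF r q False]]) (use fx x in \<open>simp add: path_elem_def\<close>)
  next
    case True
    have "path_coord r f ?b = 0" using f by (simp add: path_kernel_def)
    then have sum: "sum f (weighted_paths r ?b) = 0"
      using True by (simp add: path_coord_def weighted_coeff_def)
    have "x \<in> weighted_paths r ?b" using q x by (simp add: weighted_paths_iff)
    then have "sum f (weighted_paths r ?b - {x}) \<noteq> 0"
      using sum fx sum.remove[OF finite_weighted_paths[OF r], of x ?b f] by auto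
    then obtain y where y: "y \<in> weighted_paths r ?b - {x}" "f y \<noteq> 0"
      by (rule sum.not_neutral_contains_not_neutral)
    then obtain s where s: "y = (u, s, v)" "(u, s, v) \<in> qpaths B_quiver" "weight r p = weight r s" "p \<noteq> s"
      using x by (fastforce simp: weighted_paths_iff)
    have carr: "(path_elem (u, p, v) :: _ \<Rightarrow> 'k) \<in> carrier B_paths" "(path_elem (u, s, v) :: _ \<Rightarrow> 'k) \<in> carrier B_paths"
      using q s(2) by (simp_all add: path_elem_closed)
    have "(\<lambda>z. path_elem (u, p, v) z - path_elem (u, s, v) z) \<in> Idl\<^bsub>B_paths\<^esub> (B_relations r :: (_ \<Rightarrow> 'k) set)"
      unfolding B_quiver.path_algebra_minus[OF carr, symmetric]
      by (rule relation_ideal_paths(2)[OF r q s(2,3)])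
    then show ?thesis
      by (rule rev_bexI) (use fx x y s in \<open>auto simp: path_elem_def\<close>)
  qed
qed

text \<open>
  An element whose coordinates vanish is reduced to zero by subtracting elements of the ideal that
  remove one path from its support without adding a new one.
\<close>

lemma path_kernel_eq_relation_ideal:
  assumes r: "r \<ge> 1"
  shows "Idl\<^bsub>B_paths\<^esub> (B_relations r) = (path_kernel r :: ((nat, arrow) qpath \<Rightarrow> 'k::field) set)"
proof
  let ?P = "B_paths :: ('k, (nat, arrow) qpath \<Rightarrow> 'k) module"
  let ?I = "Idl\<^bsub>?P\<^esub> (B_relations r)"
  show IK: "?I \<subseteq> path_kernel r"
    by (rule B_paths.genideal_minimal[OF ideal_path_kernel[OF r] B_relations_in_kernel[OF r]])
  have I: "ideal ?I ?P"
    by (rule B_paths.genideal_ideal[OF B_relations_carrier[OF r]])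
  note I_sub = ideal.axioms(1)[OF I]
  note K_sub = ideal.axioms(1)[OF ideal_path_kernel[OF r]]
  show "path_kernel r \<subseteq> ?I"
  proof
    fix f :: "(nat, arrow) qpath \<Rightarrow> 'k"
    assume "f \<in> path_kernel r"
    then show "f \<in> ?I"
    proof (induction "card {x. f x \<noteq> 0}" arbitrary: f rule: less_induct)
      case less
      have fc: "f \<in> carrier ?P" using less.prems by (simp add: path_kernel_def)
      show ?case
      proof (cases "\<exists>x. f x \<noteq> 0")
        case False
        then have "f = \<zero>\<^bsub>?P\<^esub>" by (auto simp: path_algebra_simps)
        then show ?thesis using additive_subgroup.zero_closed[OF I_sub] by simp
      next
        case True
        then obtain x where fx: "f x \<noteq> 0" by blast
        obtain d where d: "d \<in> ?I" "d x = 1" "\<forall>z. d z \<noteq> 0 \<longrightarrow> f z \<noteq> 0"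
          using relation_ideal_support_reduction[OF r less.prems fx] by blast
        define e where "e = f x \<odot>\<^bsub>?P\<^esub> d"
        have eI: "e \<in> ?I" unfolding e_def by (rule B_quiver.path_ideal_smult[OF I d(1)])
        have ec: "e \<in> carrier ?P" by (rule ideal.Icarr[OF I eI])
        have gK: "f \<ominus>\<^bsub>?P\<^esub> e \<in> path_kernel r"
          unfolding B_paths.minus_eq using less.prems eI IK
          by (intro additive_subgroup.a_closed[OF K_sub] additive_subgroup.a_inv_closed[OF K_sub]
              B_paths.abelian_group_axioms) auto
        have g: "f \<ominus>\<^bsub>?P\<^esub> e = (\<lambda>z. f z - f x * d z)"
          unfolding B_quiver.path_algebra_minus[OF fc ec] by (simp add: e_def path_algebra_simps(6))
        have "{z. (f \<ominus>\<^bsub>?P\<^esub> e) z \<noteq> 0} \<subset> {z. f z \<noteq> 0}"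
        proof -
          have "{z. (f \<ominus>\<^bsub>?P\<^esub> e) z \<noteq> 0} \<subseteq> {z. f z \<noteq> 0}"
            unfolding g using d(3) by auto
          moreover have "x \<in> {z. f z \<noteq> 0}" "x \<notin> {z. (f \<ominus>\<^bsub>?P\<^esub> e) z \<noteq> 0}"
            using fx d(2) by (simp_all add: g)
          ultimately show ?thesis by blast
        qed
        then have "card {z. (f \<ominus>\<^bsub>?P\<^esub> e) z \<noteq> 0} < card {z. f z \<noteq> 0}"
          using fc by (intro psubset_card_mono) (auto simp: path_algebra_simps(1))
        then have "f \<ominus>\<^bsub>?P\<^esub> e \<in> ?I" using less.hyps gK by blast
        then have "(f \<ominus>\<^bsub>?P\<^esub> e) \<oplus>\<^bsub>?P\<^esub> e \<in> ?I" using eI by (rule additive_subgroup.a_closed[OF I_sub])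
        also have "(f \<ominus>\<^bsub>?P\<^esub> e) \<oplus>\<^bsub>?P\<^esub> e = f"
          unfolding path_algebra_simps(5) g by (simp add: e_def path_algebra_simps(6))
        finally show ?thesis .
      qed
    qed
  qed
qed

section \<open>Coordinates on \<open>B\<^sub>r\<close>\<close>

text \<open>
  For passing from a quotient ring to the quotient algebra, which has the additional field for the
  scalar multiplication.
\<close>

lemma ring_cong:
  assumes R: "ring R" and "carrier S = carrier R" "monoid.mult S = monoid.mult R"
    "one S = one R" "zero S = zero R" "add S = add R"
  shows "ring S"
proof -
  interpret ring R by fact
  note eqs = assms(2-)
  show ?thesis
  proof (rule ringI)
    show "abelian_group S"
      by (rule abelian_groupI) (auto simp: eqs a_ac intro: l_neg)
    show "monoid S" by (rule monoidI) (auto simp: eqs m_assoc)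
  qed (auto simp: eqs l_distr r_distr)
qed

lemma quot_alg_simps:
  "carrier (quot_alg A I) = carrier (A Quot I)"
  "monoid.mult (quot_alg A I) = monoid.mult (A Quot I)"
  "one (quot_alg A I) = one (A Quot I)"
  "zero (quot_alg A I) = zero (A Quot I)"
  "add (quot_alg A I) = add (A Quot I)"
  "module.smult (quot_alg A I) = smult_coset A I"
  by (simp_all add: quot_alg_def ring.defs module.defs)

lemma smult_coset_rcos:
  fixes A :: "('k, 'a) module" (structure)
  assumes I: "ideal I A"
    and closed: "\<And>x. x \<in> carrier A \<Longrightarrow> c \<odot> x \<in> carrier A" "\<And>x. x \<in> I \<Longrightarrow> c \<odot> x \<in> I"
    and distrib: "\<And>x y. x \<in> carrier A \<Longrightarrow> y \<in> carrier A \<Longrightarrow> c \<odot> (x \<oplus> y) = c \<odot> x \<oplus> c \<odot> y"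
    and x: "x \<in> carrier A"
  shows "smult_coset A I c (I +> x) = I +> (c \<odot> x)"
proof -
  interpret ideal I A by fact
  have "I +> (c \<odot> y) = I +> (c \<odot> x)" if "y \<in> I +> x" for y
  proof -
    obtain i where i: "i \<in> I" "y = i \<oplus> x" using \<open>y \<in> I +> x\<close> by (auto simp: a_r_coset_def')
    then have "c \<odot> y = c \<odot> i \<oplus> c \<odot> x" using distrib x a_Hcarr by simp
    then have "c \<odot> y \<in> I +> (c \<odot> x)" using closed i(1) x by (auto simp: a_r_coset_def')
    then show ?thesis
      using a_repr_independence[OF _ closed(1)[OF x] a_subgroup] by simp
  qed
  moreover have "I +> x \<noteq> {}" using a_rcos_self[OF x] by blast
  ultimately show ?thesis unfolding smult_coset_def by auto
qed

lemma weight_alternating: "weight r (alternating u n) = n"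
  by (induction n) auto

lemma standard_path_weighted:
  assumes "r \<ge> 1" and "b \<in> basis r"
  shows "standard_path b \<in> weighted_paths r b"
proof -
  obtain u n v where b: "b = (u, n, v)" by (cases b)
  have "u = 1 \<or> u = 2 \<or> u = 3" "v = 1 \<or> v = 2 \<or> v = 3"
    using assms b by (auto simp: basis_def)
  then show ?thesis
    using assms alternating_in_qpaths[of u v n] qpaths_in_relations(7) arrow_in_qpaths[of C1]
      arrow_in_qpaths[of D1] arrow_in_qpaths[of C3] arrow_in_qpaths[of D3] unfolding b
    by (elim disjE; hypsubst)
      (auto simp: basis_def standard_path_def weighted_paths_iff weight_alternating qpaths_B_Nil)
qed

lemma finite_basis: "finite (basis r)"
  by (rule finite_subset[of _ "{1, 2, 3} \<times> {..2 * r} \<times> {1, 2, 3}"])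
    (auto simp: basis_def split: if_splits)

lemma path_coord_surj:
  assumes r: "r \<ge> 1" and "\<And>b. b \<notin> basis r \<Longrightarrow> \<phi> b = (0::'k::field)"
  shows "\<exists>f\<in>carrier B_paths. path_coord r f = \<phi>"
proof -
  define cls where "cls q = (fst q, weight r (fst (snd q)), snd (snd q))" for q :: "(nat, arrow) qpath"
  define f where "f q = (if cls q \<in> basis r \<and> q = standard_path (cls q) then \<phi> (cls q) else 0)" for q
  have cls: "cls q = b" if "q \<in> weighted_paths r b" for q b
    using that by (cases b) (auto simp: cls_def weighted_paths_iff)
  have "{q. f q \<noteq> 0} \<subseteq> standard_path ` basis r"
    by (auto simp: f_def split: if_splits)
  moreover have "standard_path ` basis r \<subseteq> qpaths B_quiver"
    using standard_path_weighted[OF r] by (fastforce simp: weighted_paths_def)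
  moreover have "finite (standard_path ` basis r)" by (rule finite_imageI[OF finite_basis])
  ultimately have "f \<in> carrier B_paths"
    unfolding path_algebra_simps(1) by (blast intro: finite_subset)
  moreover have "path_coord r f b = \<phi> b" for b
  proof (cases "b \<in> basis r")
    case True
    have "weighted_coeff r f b = (\<Sum>q\<in>weighted_paths r b. if q = standard_path b then \<phi> b else 0)"
      unfolding weighted_coeff_def by (rule sum.cong) (use True cls in \<open>fastforce simp: f_def\<close>)+
    then show ?thesis
      using True standard_path_weighted[OF r True]
      by (simp add: path_coord_def finite_weighted_paths[OF r])
  qed (simp add: path_coord_def assms)
  ultimately show ?thesis by blast
qed

text \<open>
  An algebra with a basis indexed by \<open>basis r\<close> in which classes are multiplied by adding their weights.
  Coordinates are functions on all triples that vanish outside \<open>basis r\<close>; thus sums over the middle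
  vertex and the weight of the first factor need no side conditions.
\<close>

locale B_coordinates = ring A for A :: "('k::field, 'a) module" (structure) +
  fixes r :: nat and coord :: "'a \<Rightarrow> nat \<times> nat \<times> nat \<Rightarrow> 'k"
  assumes r: "r \<ge> 1"
    and smult_closed: "x \<in> carrier A \<Longrightarrow> c \<odot> x \<in> carrier A"
    and coord_outside: "x \<in> carrier A \<Longrightarrow> b \<notin> basis r \<Longrightarrow> coord x b = 0"
    and coord_inject: "x \<in> carrier A \<Longrightarrow> y \<in> carrier A \<Longrightarrow> (\<And>b. coord x b = coord y b) \<Longrightarrow> x = y"
    and coord_surj: "(\<And>b. b \<notin> basis r \<Longrightarrow> \<phi> b = 0) \<Longrightarrow> \<exists>x\<in>carrier A. coord x = \<phi>"
    and coord_add: "x \<in> carrier A \<Longrightarrow> y \<in> carrier A \<Longrightarrow> coord (x \<oplus> y) b = coord x b + coord y b"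
    and coord_smult: "x \<in> carrier A \<Longrightarrow> coord (c \<odot> x) b = c * coord x b"
    and coord_one: "coord \<one> (u, n, v) = (if n = 0 \<and> u = v \<and> u \<in> {1, 2, 3} then 1 else 0)"
    and coord_mult: "x \<in> carrier A \<Longrightarrow> y \<in> carrier A \<Longrightarrow> (u, n, w) \<in> basis r \<Longrightarrow>
      coord (x \<otimes> y) (u, n, w) = (\<Sum>(m, v)\<in>{..n} \<times> {1, 2, 3}. coord x (u, m, v) * coord y (v, n - m, w))"

text \<open>
  The coordinates are constant on a coset of the ideal of relations, so any representative will do.
\<close>

definition B_coord :: "nat \<Rightarrow> ((nat, arrow) qpath \<Rightarrow> 'k::field) set \<Rightarrow> nat \<times> nat \<times> nat \<Rightarrow> 'k" where
  "B_coord r X = path_coord r (SOME f. f \<in> X)"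

lemma B_alg_coordinates:
  assumes r: "r \<ge> 1"
  shows "B_coordinates (B_alg r :: ('k::field, _) module) r (B_coord r)"
proof -
  let ?P = "B_paths :: ('k, (nat, arrow) qpath \<Rightarrow> 'k) module"
  define I where "I = (path_kernel r :: ((nat, arrow) qpath \<Rightarrow> 'k) set)"
  have I: "ideal I ?P" unfolding I_def by (rule ideal_path_kernel[OF r])
  have B: "(B_alg r :: ('k, _) module) = quot_alg ?P I"
    by (simp add: B_alg_def path_kernel_eq_relation_ideal[OF r] I_def)
  have ringB: "ring (quot_alg ?P I)"
    by (rule ring_cong[OF ideal.quotient_is_ring[OF I]]) (simp_all add: quot_alg_simps)
  have carr: "X \<in> carrier (?P Quot I) \<longleftrightarrow> (\<exists>f\<in>carrier ?P. X = I +>\<^bsub>?P\<^esub> f)" for X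
    unfolding FactRing_simps by auto
  have coord: "B_coord r (I +>\<^bsub>?P\<^esub> f) = path_coord r f" if f: "f \<in> carrier ?P" for f
  proof -
    have "f \<in> I +>\<^bsub>?P\<^esub> f" by (rule abelian_subgroup.a_rcos_self[OF abelian_subgroupI3[OF ideal.axioms(1)[OF I]] f])
        (rule B_paths.abelian_group_axioms)
    then have "(SOME g. g \<in> I +>\<^bsub>?P\<^esub> f) \<in> I +>\<^bsub>?P\<^esub> f"
      by (rule someI[where P = "\<lambda>g. g \<in> I +>\<^bsub>?P\<^esub> f"])
    then obtain i where "i \<in> I" "(SOME g. g \<in> I +>\<^bsub>?P\<^esub> f) = i \<oplus>\<^bsub>?P\<^esub> f"
      by (auto simp: a_r_coset_def')
    then show ?thesis
      by (auto simp: B_coord_def path_algebra_simps(5) path_coord_add I_def path_kernel_def)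
  qed
  have add: "(I +>\<^bsub>?P\<^esub> f) \<oplus>\<^bsub>?P Quot I\<^esub> (I +>\<^bsub>?P\<^esub> g) = I +>\<^bsub>?P\<^esub> (f \<oplus>\<^bsub>?P\<^esub> g)"
    and mult: "(I +>\<^bsub>?P\<^esub> f) \<otimes>\<^bsub>?P Quot I\<^esub> (I +>\<^bsub>?P\<^esub> g) = I +>\<^bsub>?P\<^esub> (f \<otimes>\<^bsub>?P\<^esub> g)"
    if "f \<in> carrier ?P" "g \<in> carrier ?P" for f g
    using ring_hom_add[OF ideal.rcos_ring_hom[OF I] that] ring_hom_mult[OF ideal.rcos_ring_hom[OF I] that]
    by simp_all
  have one: "\<one>\<^bsub>?P Quot I\<^esub> = I +>\<^bsub>?P\<^esub> \<one>\<^bsub>?P\<^esub>" by (simp add: FactRing_def)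
  have smc: "c \<odot>\<^bsub>?P\<^esub> f \<in> carrier ?P" if "f \<in> carrier ?P" for c f
    using that by (auto simp: path_algebra_simps elim: rev_finite_subset)
  have smult: "smult_coset ?P I c (I +>\<^bsub>?P\<^esub> f) = I +>\<^bsub>?P\<^esub> (c \<odot>\<^bsub>?P\<^esub> f)" if "f \<in> carrier ?P" for c f
    by (rule smult_coset_rcos[OF I smc B_quiver.path_ideal_smult[OF I] _ that])
      (auto simp: path_algebra_simps distrib_left)
  have inject: "I +>\<^bsub>?P\<^esub> f = I +>\<^bsub>?P\<^esub> g"
    if fg: "f \<in> carrier ?P" "g \<in> carrier ?P" and eq: "\<And>b. path_coord r f b = path_coord r g b" for f g
  proof -
    have "f \<ominus>\<^bsub>?P\<^esub> g \<in> carrier ?P" using fg by simp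
    then have "f \<ominus>\<^bsub>?P\<^esub> g \<in> I"
      using eq unfolding I_def path_kernel_def B_quiver.path_algebra_minus[OF fg]
      by (simp add: path_coord_minus)
    then show ?thesis using B_paths.quotient_eq_iff_same_a_r_cos[OF I fg] by blast
  qed
  show ?thesis
    unfolding B
  proof (rule B_coordinates.intro[OF ringB], unfold_locales, unfold quot_alg_simps)
    fix X Y :: "((nat, arrow) qpath \<Rightarrow> 'k) set" and c :: 'k and b :: "nat \<times> nat \<times> nat"
    assume X: "X \<in> carrier (?P Quot I)"
    then obtain f where f: "f \<in> carrier ?P" "X = I +>\<^bsub>?P\<^esub> f" by (auto simp only: carr)
    show "smult_coset ?P I c X \<in> carrier (?P Quot I)"
      using f smult smc by (auto simp only: carr)
    show "B_coord r (smult_coset ?P I c X) b = c * B_coord r X b"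
      by (simp only: f smult coord smc) (simp only: path_algebra_simps path_coord_smult)
    show "b \<notin> basis r \<Longrightarrow> B_coord r X b = 0"
      by (simp only: f coord path_coord_def if_False)
    assume Y: "Y \<in> carrier (?P Quot I)"
    then obtain g where g: "g \<in> carrier ?P" "Y = I +>\<^bsub>?P\<^esub> g" by (auto simp only: carr)
    show "B_coord r (X \<oplus>\<^bsub>?P Quot I\<^esub> Y) b = B_coord r X b + B_coord r Y b"
      by (simp only: f g add coord B_paths.a_closed) (simp only: path_algebra_simps path_coord_add)
    show "X = Y" if "\<And>b. B_coord r X b = B_coord r Y b"
      unfolding f(2) g(2) by (rule inject) (use that f g coord in \<open>auto simp only:\<close>)
    show "B_coord r (X \<otimes>\<^bsub>?P Quot I\<^esub> Y) (u, n, w)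
        = (\<Sum>(m, v)\<in>{..n} \<times> {1, 2, 3}. B_coord r X (u, m, v) * B_coord r Y (v, n - m, w))"
      if "(u, n, w) \<in> basis r" for u n w
      by (simp only: f g mult coord B_paths.m_closed path_coord_mult[OF r that])
  next
    fix \<phi> :: "nat \<times> nat \<times> nat \<Rightarrow> 'k"
    assume \<phi>: "\<And>b. b \<notin> basis r \<Longrightarrow> \<phi> b = 0"
    have "\<exists>f\<in>carrier ?P. path_coord r f = \<phi>" by (rule path_coord_surj[OF r \<phi>])
    then obtain f where f: "f \<in> carrier ?P" "path_coord r f = \<phi>" by (rule bexE)
    then have "I +>\<^bsub>?P\<^esub> f \<in> carrier (?P Quot I)" "B_coord r (I +>\<^bsub>?P\<^esub> f) = \<phi>"
      by (auto simp only: carr coord)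
    then show "\<exists>X\<in>carrier (?P Quot I). B_coord r X = \<phi>" by (rule rev_bexI)
  next
    show "B_coord r \<one>\<^bsub>?P Quot I\<^esub> (u, n, v) = (if n = 0 \<and> u = v \<and> u \<in> {1, 2, 3} then 1 else 0)" for u n v
      unfolding one coord[OF B_paths.one_closed] by (rule path_coord_one[OF r])
  qed (use r in simp)
qed

section \<open>Radicals, powers of ideals and their associated graded rings\<close>

context ring
begin

lemma left_idealI:
  assumes sub: "L \<subseteq> carrier R" and zero: "\<zero> \<in> L"
    and add: "\<And>x y. x \<in> L \<Longrightarrow> y \<in> L \<Longrightarrow> x \<oplus> y \<in> L"
    and mult: "\<And>a x. a \<in> carrier R \<Longrightarrow> x \<in> L \<Longrightarrow> a \<otimes> x \<in> L"
  shows "left_ideal L R"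
proof -
  have "subgroup L (add_monoid R)"
  proof (rule add.subgroupI)
    show "\<ominus> x \<in> L" if "x \<in> L" for x
    proof -
      have "\<ominus> x = (\<ominus> \<one>) \<otimes> x" using that sub by (simp add: l_minus subsetD)
      then show ?thesis using mult that by simp
    qed
  qed (use sub zero add in auto)
  then show ?thesis
    unfolding left_ideal_def using mult by (blast intro: additive_subgroupI)
qed

text \<open>
  If \<open>x\<close> lies in \<open>J\<close> but not in a maximal left ideal \<open>L\<close>, then \<open>L + Rx = R\<close>, so \<open>1 = l + y\<close> with \<open>l\<close> in
  \<open>L\<close> and a nilpotent \<open>y\<close>. As \<open>1 - y\<close> lies in \<open>L\<close>, so does \<open>1 - y\<^sup>n\<close> for each \<open>n\<close>, and finally \<open>1\<close>.
\<close>

lemma nil_left_ideal_subset_jacobson_radical: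
  assumes J: "left_ideal J R" and nil: "\<And>x. x \<in> J \<Longrightarrow> \<exists>n::nat. x [^] n = \<zero>"
  shows "J \<subseteq> jacobson_radical R"
proof
  fix x assume x: "x \<in> J"
  have J': "additive_subgroup J R" "\<And>a y. a \<in> carrier R \<Longrightarrow> y \<in> J \<Longrightarrow> a \<otimes> y \<in> J"
    using J by (auto simp: left_ideal_def)
  have xc: "x \<in> carrier R" by (rule additive_subgroup.a_Hcarr[OF J'(1) x])
  have "x \<in> L" if L: "maximal_left_ideal L R" for L
  proof (rule ccontr)
    assume xL: "x \<notin> L"
    have L': "additive_subgroup L R" "\<And>a y. a \<in> carrier R \<Longrightarrow> y \<in> L \<Longrightarrow> a \<otimes> y \<in> L"
      "L \<noteq> carrier R" "\<And>M. left_ideal M R \<Longrightarrow> L \<subseteq> M \<Longrightarrow> M = L \<or> M = carrier R"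
      using L by (auto simp: maximal_left_ideal_def left_ideal_def)
    note Lc = additive_subgroup.a_Hcarr[OF L'(1)]
    note L0 = additive_subgroup.zero_closed[OF L'(1)]
    define M where "M = {l \<oplus> a \<otimes> x | l a. l \<in> L \<and> a \<in> carrier R}"
    have "left_ideal M R"
    proof (rule left_idealI)
      show "M \<subseteq> carrier R" using Lc xc by (auto simp: M_def)
      have "\<zero> = \<zero> \<oplus> \<zero> \<otimes> x" using xc by simp
      then show "\<zero> \<in> M" unfolding M_def using L0 by blast
    next
      fix y z assume "y \<in> M" "z \<in> M"
      then obtain l a l' a' where y: "y = l \<oplus> a \<otimes> x" "l \<in> L" "a \<in> carrier R"
        and z: "z = l' \<oplus> a' \<otimes> x" "l' \<in> L" "a' \<in> carrier R" unfolding M_def by blast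
      have "y \<oplus> z = (l \<oplus> l') \<oplus> (a \<oplus> a') \<otimes> x"
        using y z xc Lc by (simp add: l_distr a_ac)
      then show "y \<oplus> z \<in> M"
        unfolding M_def using y(2,3) z(2,3) additive_subgroup.a_closed[OF L'(1)] by blast
    next
      fix b y assume b: "b \<in> carrier R" and "y \<in> M"
      then obtain l a where y: "y = l \<oplus> a \<otimes> x" "l \<in> L" "a \<in> carrier R" unfolding M_def by blast
      have "b \<otimes> y = b \<otimes> l \<oplus> (b \<otimes> a) \<otimes> x"
        using y b xc Lc by (simp add: r_distr m_assoc)
      then show "b \<otimes> y \<in> M" unfolding M_def using y(2,3) b L'(2) by blast
    qed
    moreover have "L \<subseteq> M"
    proof
      fix l assume l: "l \<in> L"
      then have "l = l \<oplus> \<zero> \<otimes> x" using xc Lc by simp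
      then show "l \<in> M" unfolding M_def using l by blast
    qed
    moreover have "x \<in> M"
    proof -
      have "x = \<zero> \<oplus> \<one> \<otimes> x" using xc by simp
      then show ?thesis unfolding M_def using L0 by blast
    qed
    ultimately have "M = carrier R" using L'(4) xL by blast
    then obtain l a where la: "\<one> = l \<oplus> a \<otimes> x" "l \<in> L" "a \<in> carrier R" unfolding M_def by blast
    define y where "y = a \<otimes> x"
    have y: "y \<in> J" "y \<in> carrier R" using J'(2) x la(3) xc by (simp_all add: y_def)
    have l: "l = \<one> \<ominus> y" unfolding la(1) y_def using la(2,3) xc Lc by (simp add: minus_eq a_ac r_neg)
    have "\<one> \<ominus> y [^] n \<in> L" for n :: nat
    proof (induction n)
      case 0
      then show ?case using L0 by (simp add: minus_eq r_neg)
    next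
      case (Suc n)
      have yn: "y [^] n \<in> carrier R" using y(2) by simp
      have "\<one> \<ominus> y [^] Suc n = (\<one> \<ominus> y [^] n) \<oplus> y [^] n \<otimes> l"
      proof -
        have "y [^] n \<otimes> l = y [^] n \<ominus> y [^] Suc n"
          unfolding l minus_eq using y(2) yn by (simp add: r_distr r_minus)
        then show ?thesis unfolding minus_eq using y(2) yn
          by (simp add: a_assoc) (simp add: a_assoc[symmetric] l_neg)
      qed
      moreover have "y [^] n \<otimes> l \<in> L" using L'(2)[OF yn la(2)] .
      ultimately show ?case using Suc additive_subgroup.a_closed[OF L'(1)] by simp
    qed
    moreover obtain n :: nat where "y [^] n = \<zero>" using nil[OF y(1)] by blast
    ultimately have one: "\<one> \<in> L" by (metis minus_eq minus_zero r_zero one_closed)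
    have "carrier R \<subseteq> L" using L'(2)[OF _ one] by auto
    then show False using L'(3) Lc by blast
  qed
  then show "x \<in> jacobson_radical R" unfolding jacobson_radical_def using xc by blast
qed

text \<open>
  If \<open>y\<close> lies in a larger left ideal but not in the kernel, some multiple \<open>zy\<close> has the value 1, and
  \<open>1 - zy\<close> lies in the kernel.
\<close>

lemma character_kernel_maximal_left_ideal:
  fixes \<chi> :: "'a \<Rightarrow> 'k::field"
  assumes add: "\<And>x y. x \<in> carrier R \<Longrightarrow> y \<in> carrier R \<Longrightarrow> \<chi> (x \<oplus> y) = \<chi> x + \<chi> y"
    and mult: "\<And>x y. x \<in> carrier R \<Longrightarrow> y \<in> carrier R \<Longrightarrow> \<chi> (x \<otimes> y) = \<chi> x * \<chi> y"
    and one: "\<chi> \<one> = 1" and surj: "\<And>c. \<exists>x \<in> carrier R. \<chi> x = c"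
  shows "maximal_left_ideal {x \<in> carrier R. \<chi> x = 0} R"
proof -
  let ?K = "{x \<in> carrier R. \<chi> x = 0}"
  have zero: "\<chi> \<zero> = 0" using add[of \<zero> \<zero>] by (metis add_cancel_right_right l_zero zero_closed)
  have neg: "\<chi> (\<ominus> x) = - \<chi> x" if "x \<in> carrier R" for x
    using add[of x "\<ominus> x"] that zero by (simp add: r_neg eq_neg_iff_add_eq_0 add.commute)
  have "left_ideal ?K R" by (rule left_idealI) (auto simp: zero add mult)
  moreover have "?K \<noteq> carrier R" using one one_closed by force
  moreover have "M = ?K \<or> M = carrier R" if M: "left_ideal M R" "?K \<subseteq> M" for M
  proof (rule disjCI)
    assume "M \<noteq> carrier R"
    have M': "additive_subgroup M R" "\<And>a y. a \<in> carrier R \<Longrightarrow> y \<in> M \<Longrightarrow> a \<otimes> y \<in> M"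
      using M by (auto simp: left_ideal_def)
    have "\<chi> y = 0" if y: "y \<in> M" for y
    proof (rule ccontr)
      assume ne: "\<chi> y \<noteq> 0"
      have yc: "y \<in> carrier R" by (rule additive_subgroup.a_Hcarr[OF M'(1) y])
      obtain z where z: "z \<in> carrier R" "\<chi> z = 1 / \<chi> y" using surj by blast
      have "\<one> \<ominus> z \<otimes> y \<in> ?K" using z yc ne by (simp add: minus_eq add mult neg one)
      then have "(\<one> \<ominus> z \<otimes> y) \<oplus> z \<otimes> y \<in> M"
        using M(2) M'(2)[OF z(1) y] additive_subgroup.a_closed[OF M'(1)] by blast
      then have "\<one> \<in> M" using z(1) yc by (simp add: minus_eq a_assoc l_neg)
      then have "carrier R \<subseteq> M" using M'(2)[of _ \<one>] by auto
      then show False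
        using \<open>M \<noteq> carrier R\<close> additive_subgroup.a_subset[OF M'(1)] by blast
    qed
    then show "M = ?K" using M(2) additive_subgroup.a_subset[OF M'(1)] by blast
  qed
  ultimately show ?thesis unfolding maximal_left_ideal_def by blast
qed

lemma ideal_ideal_power: "ideal I R \<Longrightarrow> ideal (ideal_power R I n) R"
  by (induction n) (simp_all add: oneideal ideal_prod_is_ideal)

lemma ideal_power_Suc_subset: "ideal I R \<Longrightarrow> ideal_power R I (Suc n) \<subseteq> ideal_power R I n"
  using ideal_prod_inter[OF ideal_ideal_power] by simp

lemma ideal_power_mult:
  assumes I: "ideal I R" and x: "x \<in> ideal_power R I i" and y: "y \<in> ideal_power R I j"
  shows "x \<otimes> y \<in> ideal_power R I (i + j)"
  using y
proof (induction j arbitrary: y)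
  case 0
  then show ?case using ideal.I_r_closed[OF ideal_ideal_power[OF I] x] by simp
next
  case (Suc j)
  have xc: "x \<in> carrier R" by (rule ideal.Icarr[OF ideal_ideal_power[OF I] x])
  have "y \<in> ideal_prod R (ideal_power R I j) I" using Suc.prems by simp
  then have "x \<otimes> y \<in> ideal_prod R (ideal_power R I (i + j)) I"
  proof (induction y rule: ideal_prod.induct)
    case (prod a b)
    have "a \<in> carrier R" "b \<in> carrier R"
      using prod ideal.Icarr[OF ideal_ideal_power[OF I]] ideal.Icarr[OF I] by auto
    then have "x \<otimes> (a \<otimes> b) = (x \<otimes> a) \<otimes> b" using xc by (simp add: m_assoc)
    then show ?case using ideal_prod.prod[OF Suc.IH[OF prod(1)] prod(2)] by simp
  next
    case (sum s t)
    have "s \<in> carrier R" "t \<in> carrier R"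
      using sum(1,2) ideal_prod_in_carrier[OF ideal_ideal_power[OF I] I] by auto
    then show ?case using xc sum.IH by (simp add: r_distr ideal_prod.sum)
  qed
  then show ?case by simp
qed

lemma rcos_eq_iff:
  assumes "ideal I R" "x \<in> carrier R" "y \<in> carrier R"
  shows "I +> x = I +> y \<longleftrightarrow> x \<ominus> y \<in> I"
  using quotient_eq_iff_same_a_r_cos[OF assms] by simp

lemma rcos_eq_self_iff:
  assumes "ideal I R" "x \<in> carrier R"
  shows "I +> x = I \<longleftrightarrow> x \<in> I"
proof -
  have "I +> \<zero> = I" by (rule a_rcos_zero[OF assms(1) additive_subgroup.zero_closed[OF ideal.axioms(1)[OF assms(1)]]])
  then show ?thesis using rcos_eq_iff[OF assms zero_closed] assms(2) by (simp add: minus_eq)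
qed

text \<open>
  The product of graded components is independent of the representatives: changing \<open>x\<close> within
  \<open>I\<^sup>i\<^sup>+\<^sup>1\<close> or \<open>y\<close> within \<open>I\<^sup>j\<^sup>+\<^sup>1\<close> changes \<open>xy\<close> within \<open>I\<^sup>i\<^sup>+\<^sup>j\<^sup>+\<^sup>1\<close>.
\<close>

lemma gr_prod_rcos:
  assumes I: "ideal I R" and x: "x \<in> ideal_power R I i" and y: "y \<in> ideal_power R I j"
  shows "gr_prod R I i j (ideal_power R I (Suc i) +> x) (ideal_power R I (Suc j) +> y)
    = ideal_power R I (Suc (i + j)) +> (x \<otimes> y)"
proof -
  note ii = ideal_ideal_power[OF I]
  note car = ideal.Icarr[OF ii]
  let ?K = "ideal_power R I (Suc (i + j))"
  have "?K +> (x' \<otimes> y') = ?K +> (x \<otimes> y)"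
    if x': "x' \<in> ideal_power R I (Suc i) +> x" and y': "y' \<in> ideal_power R I (Suc j) +> y" for x' y'
  proof -
    obtain a where a: "a \<in> ideal_power R I (Suc i)" "x' = a \<oplus> x" using x' by (auto simp: a_r_coset_def')
    obtain b where b: "b \<in> ideal_power R I (Suc j)" "y' = b \<oplus> y" using y' by (auto simp: a_r_coset_def')
    have b': "b \<in> ideal_power R I j" using b(1) ideal_power_Suc_subset[OF I] by blast
    have c: "a \<in> carrier R" "b \<in> carrier R" "x \<in> carrier R" "y \<in> carrier R"
      using car a(1) b(1) x y by blast+
    have "a \<otimes> b \<in> ?K" "a \<otimes> y \<in> ?K" "x \<otimes> b \<in> ?K"
      using ideal_power_mult[OF I a(1) b'] ideal_power_mult[OF I a(1) y] ideal_power_mult[OF I x b(1)]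
      by simp_all
    then have k: "a \<otimes> b \<oplus> a \<otimes> y \<oplus> x \<otimes> b \<in> ?K"
      using additive_subgroup.a_closed[OF ideal.axioms(1)[OF ii[of "Suc (i + j)"]]] by blast
    have "x' \<otimes> y' \<ominus> x \<otimes> y = a \<otimes> b \<oplus> a \<otimes> y \<oplus> x \<otimes> b"
    proof -
      have "x' \<otimes> y' = (a \<otimes> b \<oplus> a \<otimes> y \<oplus> x \<otimes> b) \<oplus> x \<otimes> y"
        using c by (simp add: a(2) b(2) l_distr r_distr a_ac)
      then show ?thesis using c by (simp add: minus_eq a_assoc r_neg)
    qed
    then show ?thesis
      using rcos_eq_iff[OF ii[of "Suc (i + j)"], of "x' \<otimes> y'" "x \<otimes> y"] k c a(2) b(2)
      by (simp del: ideal_power.simps)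
  qed
  moreover have "x \<in> ideal_power R I (Suc i) +> x" "y \<in> ideal_power R I (Suc j) +> y"
    using abelian_subgroup.a_rcos_self[OF abelian_subgroupI3[OF ideal.axioms(1)[OF ii] abelian_group_axioms]]
      car x y by blast+
  ultimately show ?thesis unfolding gr_prod_def by blast
qed

end

section \<open>The weight filtration and the radical\<close>

context B_coordinates
begin

lemma coord_zero: "coord \<zero> b = 0"
  using coord_add[of \<zero> \<zero> b] by (metis add_cancel_right_right l_zero zero_closed)

lemma coord_a_inv: "x \<in> carrier A \<Longrightarrow> coord (\<ominus> x) b = - coord x b"
  using coord_add[of x "\<ominus> x" b] by (simp add: r_neg coord_zero eq_neg_iff_add_eq_0 add.commute)

lemma coord_minus:
  "x \<in> carrier A \<Longrightarrow> y \<in> carrier A \<Longrightarrow> coord (x \<ominus> y) b = coord x b - coord y b"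
  by (simp add: minus_eq coord_add coord_a_inv)

lemma basis_bounds:
  "(u, m, v) \<in> basis r \<Longrightarrow> u \<in> {1, 2, 3} \<and> v \<in> {1, 2, 3} \<and> m \<le> 2 * r"
  by (auto simp: basis_def split: if_splits)

text \<open>
  Each class can be completed on the right to a class of top weight \<open>2r\<close>. The coordinates of top weight
  thus provide the nondegenerate form of a Frobenius algebra.
\<close>

lemma basis_dual:
  "(u, m, v) \<in> basis r \<Longrightarrow> (v, 2 * r - m, u) \<in> basis r \<and> (u, 2 * r, u) \<in> basis r"
  by (auto simp: basis_def split: if_splits)

lemma basis_top_iff: "(u, 2 * r, v) \<in> basis r \<longleftrightarrow> u = v \<and> u \<in> {1, 2, 3}"
  using r by (auto simp: basis_def split: if_splits)

definition of_coords :: "(nat \<times> nat \<times> nat \<Rightarrow> 'k) \<Rightarrow> 'a" where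
  "of_coords \<phi> = (SOME x. x \<in> carrier A \<and> coord x = (\<lambda>b. if b \<in> basis r then \<phi> b else 0))"

lemma of_coords: "of_coords \<phi> \<in> carrier A" "coord (of_coords \<phi>) b = (if b \<in> basis r then \<phi> b else 0)"
proof -
  have "\<exists>x. x \<in> carrier A \<and> coord x = (\<lambda>b. if b \<in> basis r then \<phi> b else 0)"
    using coord_surj[of "\<lambda>b. if b \<in> basis r then \<phi> b else 0"] by auto
  then have "of_coords \<phi> \<in> carrier A \<and> coord (of_coords \<phi>) = (\<lambda>b. if b \<in> basis r then \<phi> b else 0)"
    unfolding of_coords_def by (rule someI_ex)
  then show "of_coords \<phi> \<in> carrier A" "coord (of_coords \<phi>) b = (if b \<in> basis r then \<phi> b else 0)" by auto
qed

definition basis_multiple :: "nat \<times> nat \<times> nat \<Rightarrow> 'k \<Rightarrow> 'a" where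
  "basis_multiple b c = of_coords (\<lambda>b'. if b' = b then c else 0)"

lemma basis_multiple:
  "basis_multiple b c \<in> carrier A"
  "coord (basis_multiple b c) b' = (if b' = b \<and> b \<in> basis r then c else 0)"
  by (simp_all add: basis_multiple_def of_coords)

lemma coord_basis_multiple_mult:
  assumes y: "y \<in> carrier A" and b: "(u, m, v) \<in> basis r" and b': "(u', n, w) \<in> basis r"
  shows "coord (basis_multiple (u, m, v) c \<otimes> y) (u', n, w)
    = (if u = u' \<and> m \<le> n then c * coord y (v, n - m, w) else 0)"
proof -
  have v: "v \<in> {1, 2, 3}" using basis_bounds[OF b] by simp
  have "coord (basis_multiple (u, m, v) c \<otimes> y) (u', n, w)
      = (\<Sum>i\<in>{..n} \<times> {1, 2, 3}. if i = (m, v) then (if u = u' then c * coord y (v, n - m, w) else 0) else 0)"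
    unfolding coord_mult[OF basis_multiple(1) y b']
    by (rule sum.cong) (auto simp: basis_multiple(2) b split: if_splits)
  then show ?thesis using v by simp
qed

lemma coord_mult_basis_multiple:
  assumes x: "x \<in> carrier A" and b: "(v, m, w) \<in> basis r" and b': "(u, n, w') \<in> basis r"
  shows "coord (x \<otimes> basis_multiple (v, m, w) c) (u, n, w')
    = (if w = w' \<and> m \<le> n then coord x (u, n - m, v) * c else 0)"
proof -
  have v: "v \<in> {1, 2, 3}" using basis_bounds[OF b] by simp
  have "coord (x \<otimes> basis_multiple (v, m, w) c) (u, n, w')
      = (\<Sum>i\<in>{..n} \<times> {1, 2, 3}. if i = (n - m, v) then (if w = w' \<and> m \<le> n then coord x (u, n - m, v) * c else 0) else 0)"
    unfolding coord_mult[OF x basis_multiple(1) b']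
    by (rule sum.cong) (auto simp: basis_multiple(2) b split: if_splits)
  then show ?thesis using v by simp
qed

definition filtration :: "nat \<Rightarrow> 'a set" where
  "filtration n = {x \<in> carrier A. \<forall>u m v. m < n \<longrightarrow> coord x (u, m, v) = 0}"

abbreviation J :: "'a set" where
  "J \<equiv> filtration (Suc 0)"

lemma filtration_mult:
  assumes x: "x \<in> filtration m" and y: "y \<in> filtration n"
  shows "x \<otimes> y \<in> filtration (m + n)"
proof -
  have carr: "x \<in> carrier A" "y \<in> carrier A" using x y by (auto simp: filtration_def)
  have "coord (x \<otimes> y) (u, l, w) = 0" if "l < m + n" for u l w
  proof (cases "(u, l, w) \<in> basis r")
    case True
    have "coord x (u, i, v) * coord y (v, l - i, w) = 0" if "i \<le> l" for i v
      using x y \<open>l < m + n\<close> that by (cases "i < m") (auto simp: filtration_def)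
    then show ?thesis
      unfolding coord_mult[OF carr True] by (intro sum.neutral) auto
  qed (simp add: coord_outside carr)
  then show ?thesis using carr by (simp add: filtration_def)
qed

lemma filtration_0: "filtration 0 = carrier A"
  by (auto simp: filtration_def)

lemma filtration_left_ideal: "left_ideal (filtration n) A"
proof (rule left_idealI)
  show "a \<otimes> x \<in> filtration n" if "a \<in> carrier A" "x \<in> filtration n" for a x
    using filtration_mult[of a 0 x n] that by (simp add: filtration_0)
qed (auto simp: filtration_def coord_zero coord_add)

lemma filtration_ideal: "ideal (filtration n) A"
proof (rule idealI[OF ring_axioms])
  show "subgroup (filtration n) (add_monoid A)"
    using filtration_left_ideal unfolding left_ideal_def by (blast intro: additive_subgroup.a_subgroup)
  show "a \<otimes> x \<in> filtration n" "x \<otimes> a \<in> filtration n" if "x \<in> filtration n" "a \<in> carrier A" for a x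
    using filtration_mult[of a 0 x n] filtration_mult[of x n a 0] that by (simp_all add: filtration_0)
qed

lemma filtration_power: "x \<in> J \<Longrightarrow> x [^] n \<in> filtration n"
proof (induction n)
  case 0
  then show ?case by (simp add: filtration_0)
next
  case (Suc n)
  then show ?case using filtration_mult[of "x [^] n" n x "Suc 0"] by simp
qed

lemma filtration_top: "x \<in> filtration (2 * r + 1) \<longleftrightarrow> x = \<zero>"
proof
  assume x: "x \<in> filtration (2 * r + 1)"
  have "coord x b = coord \<zero> b" for b
  proof (cases "b \<in> basis r")
    case True
    obtain u m v where b: "b = (u, m, v)" by (cases b)
    have "m < 2 * r + 1" using basis_bounds True b by fastforce
    then show ?thesis using x b by (simp add: filtration_def coord_zero)
  next
    case False
    then show ?thesis using x by (simp add: coord_outside filtration_def coord_zero)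
  qed
  then show "x = \<zero>" using coord_inject x by (simp add: filtration_def)
qed (simp add: filtration_def coord_zero)

text \<open>
  A coordinate of weight 0 is a character, since a product of weight 0 at \<open>u\<close> has only the trivial path
  at \<open>u\<close> as its factors.
\<close>

lemma coord_vertex_mult:
  assumes "x \<in> carrier A" "y \<in> carrier A" and u: "u \<in> {1, 2, 3}"
  shows "coord (x \<otimes> y) (u, 0, u) = coord x (u, 0, u) * coord y (u, 0, u)"
proof -
  have b: "(u, 0, v) \<in> basis r \<longleftrightarrow> u = v" for v using basis_weight_0_iff[OF r] u by auto
  have zero: "coord x (u, 0, v) = 0" if "u \<noteq> v" for v
    using coord_outside[OF assms(1)] b that by auto
  have "coord (x \<otimes> y) (u, 0, u) = (\<Sum>i\<in>{..0::nat} \<times> {1, 2, 3}. if i = (0, u) then coord x (u, 0, u) * coord y (u, 0, u) else 0)"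
    unfolding coord_mult[OF assms(1,2) b[THEN iffD2, OF refl]]
    by (rule sum.cong) (auto, (metis zero)+)
  then show ?thesis using u by auto
qed

lemma J_iff:
  "x \<in> J \<longleftrightarrow> x \<in> carrier A \<and> (\<forall>u\<in>{1, 2, 3}. coord x (u, 0, u) = 0)"
proof -
  have "coord x (u, 0, v) = 0" if "x \<in> carrier A" "\<forall>u\<in>{1, 2, 3}. coord x (u, 0, u) = 0" for u v
    using that coord_outside[of x "(u, 0, v)"] basis_weight_0_iff[OF r, of u v] by metis
  then show ?thesis by (auto simp: filtration_def)
qed

text \<open>
  Elements of positive weight are nilpotent because the weights are bounded by \<open>2r\<close>. Conversely, \<open>J\<close> is
  the intersection of the kernels of the three characters given by the coordinates of weight 0.
\<close>

lemma jacobson_radical_eq_J: "jacobson_radical A = J"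
proof
  show "J \<subseteq> jacobson_radical A"
  proof (rule nil_left_ideal_subset_jacobson_radical[OF filtration_left_ideal])
    fix x assume "x \<in> J"
    then have "x [^] (2 * r + 1) \<in> filtration (2 * r + 1)" by (rule filtration_power)
    then show "\<exists>n::nat. x [^] n = \<zero>" unfolding filtration_top by blast
  qed
  have maximal: "maximal_left_ideal {x \<in> carrier A. coord x (u, 0, u) = 0} A" if u: "u \<in> {1, 2, 3}" for u
  proof (rule character_kernel_maximal_left_ideal)
    show "\<exists>x\<in>carrier A. coord x (u, 0, u) = c" for c
      by (rule bexI[of _ "basis_multiple (u, 0, u) c"])
        (use basis_weight_0_iff[OF r, of u u] u in \<open>auto simp: basis_multiple\<close>)
    show "coord (x \<oplus> y) (u, 0, u) = coord x (u, 0, u) + coord y (u, 0, u)"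
      "coord (x \<otimes> y) (u, 0, u) = coord x (u, 0, u) * coord y (u, 0, u)"
      if "x \<in> carrier A" "y \<in> carrier A" for x y
      by (rule coord_add[OF that], rule coord_vertex_mult[OF that u])
    show "coord \<one> (u, 0, u) = 1" unfolding coord_one using u by simp
  qed
  show "jacobson_radical A \<subseteq> J"
  proof
    fix x assume x: "x \<in> jacobson_radical A"
    have "coord x (u, 0, u) = 0" if "u \<in> {1, 2, 3}" for u
      using x maximal[OF that] by (auto simp: jacobson_radical_def)
    moreover have "x \<in> carrier A" using x by (simp add: jacobson_radical_def)
    ultimately show "x \<in> J" unfolding J_iff by blast
  qed
qed

lemma J_power_ideal: "ideal (ideal_power A J n) A"
  by (rule ideal_ideal_power[OF filtration_ideal])

lemma J_power_subset_filtration: "ideal_power A J n \<subseteq> filtration n"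
proof (induction n)
  case 0
  then show ?case by (simp add: filtration_0)
next
  case (Suc n)
  show ?case
  proof
    fix x assume "x \<in> ideal_power A J (Suc n)"
    then have "x \<in> ideal_prod A (ideal_power A J n) J" by simp
    then show "x \<in> filtration (Suc n)"
    proof (induction x rule: ideal_prod.induct)
      case (prod a b)
      then show ?case using Suc.IH filtration_mult[of a n b "Suc 0"] by auto
    next
      case (sum s t)
      then show ?case by (auto simp: filtration_def coord_add)
    qed
  qed
qed

lemma J_power_1: "ideal_power A J (Suc 0) = J"
proof
  show "ideal_power A J (Suc 0) \<subseteq> J" by (rule J_power_subset_filtration)
  show "J \<subseteq> ideal_power A J (Suc 0)"
  proof
    fix x assume x: "x \<in> J"
    then have "\<one> \<otimes> x \<in> ideal_prod A (carrier A) J" by (intro ideal_prod.prod) auto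
    then show "x \<in> ideal_power A J (Suc 0)" using x by (simp add: filtration_def)
  qed
qed

lemma gr_component_iff:
  "X \<in> gr_component A J i \<longleftrightarrow> (\<exists>x\<in>ideal_power A J i. X = ideal_power A J (Suc i) +> x)"
  by (auto simp: gr_component_def)

end

section \<open>The case \<open>r = 1\<close>\<close>

(* A power of the radical with a successor exponent has to stay intact as the modulus of a coset. *)
declare ideal_power.simps [simp del]

lemma gr_alg_simps:
  "carrier (gr_alg A I) =
     {f. (\<forall>i. f i \<in> gr_component A I i) \<and> finite {i. f i \<noteq> ideal_power A I (Suc i)}}"
  "(f \<otimes>\<^bsub>gr_alg A I\<^esub> g) n = finsum (A Quot ideal_power A I (Suc n))
     (\<lambda>i. gr_prod A I i (n - i) (f i) (g (n - i))) {..n}"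
  "\<one>\<^bsub>gr_alg A I\<^esub> i = (if i = 0 then ideal_power A I 1 +>\<^bsub>A\<^esub> \<one>\<^bsub>A\<^esub> else ideal_power A I (Suc i))"
  "\<zero>\<^bsub>gr_alg A I\<^esub> i = ideal_power A I (Suc i)"
  "(f \<oplus>\<^bsub>gr_alg A I\<^esub> g) i = f i <+>\<^bsub>A\<^esub> g i"
  "(c \<odot>\<^bsub>gr_alg A I\<^esub> f) i = smult_coset A (ideal_power A I (Suc i)) c (f i)"
  by (simp_all add: gr_alg_def)

lemma (in ideal) rcos_finsum:
  assumes "finite S" "f \<in> S \<rightarrow> carrier R"
  shows "finsum (R Quot I) (\<lambda>i. I +> f i) S = I +> finsum R f S"
proof -
  interpret Q: ring "R Quot I" by (rule quotient_is_ring)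
  have closed: "I +> x \<in> carrier (R Quot I)" if "x \<in> carrier R" for x
    using ring_hom_closed[OF rcos_ring_hom that] .
  show ?thesis
    using assms
  proof (induction S rule: finite_induct)
    case empty
    have "\<zero>\<^bsub>R Quot I\<^esub> = I" by (simp only: FactRing_def ring.simps)
    moreover have "I +> \<zero> = I"
      by (rule a_rcos_zero[OF ideal_axioms additive_subgroup.zero_closed[OF additive_subgroup_axioms]])
    ultimately show ?case by (simp only: Q.finsum_empty finsum_empty)
  next
    case (insert i S)
    then have "finsum (R Quot I) (\<lambda>i. I +> f i) (insert i S)
        = (I +> f i) \<oplus>\<^bsub>R Quot I\<^esub> (I +> finsum R f S)"
      using closed by (subst Q.finsum_insert) auto
    also have "\<dots> = I +> (f i \<oplus> finsum R f S)"
      by (rule ring_hom_add[OF rcos_ring_hom, symmetric]) (use insert in auto)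
    finally show ?case using insert by (subst finsum_insert) auto
  qed
qed

context B_coordinates
begin

text \<open>
  The elements of top weight are combinations of \<open>c\<^sub>1d\<^sub>1\<close>, \<open>d\<^sub>1c\<^sub>1\<close> and \<open>c\<^sub>3d\<^sub>3\<close>, hence sums of products of
  elements of the radical. For \<open>r = 1\<close> this identifies the square of the radical, and for \<open>r \<ge> 2\<close> it
  applies to the annihilator of the radical.
\<close>

lemma top_decomposition:
  assumes x: "x \<in> filtration (2 * r)"
  shows "x = basis_multiple (1, r, 2) 1 \<otimes> basis_multiple (2, r, 1) (coord x (1, 2 * r, 1)) \<oplus>
    basis_multiple (2, r, 1) 1 \<otimes> basis_multiple (1, r, 2) (coord x (2, 2 * r, 2)) \<oplus>
    basis_multiple (3, r, 1) 1 \<otimes> basis_multiple (1, r, 3) (coord x (3, 2 * r, 3))"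
    (is "x = ?y")
proof (rule coord_inject)
  show xc: "x \<in> carrier A" using x by (simp add: filtration_def)
  show yc: "?y \<in> carrier A" by (simp add: basis_multiple(1))
  have b: "(1, r, 2) \<in> basis r" "(2, r, 1) \<in> basis r" "(3, r, 1) \<in> basis r" "(1, r, 3) \<in> basis r"
    by (auto simp: basis_def)
  show "coord x b = coord ?y b" for b
  proof (cases "b \<in> basis r")
    case True
    obtain u n v where uv: "b = (u, n, v)" by (cases b)
    have "coord ?y b = (if u = v \<and> n = 2 * r \<and> u \<in> {1, 2, 3} then coord x b else 0)"
      using True unfolding uv
      by (auto simp: coord_add basis_multiple coord_basis_multiple_mult b simp del: One_nat_def)
    moreover have "coord x b = 0" if "\<not> (u = v \<and> n = 2 * r \<and> u \<in> {1, 2, 3})"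
      using that x True basis_top_iff[of u v] basis_bounds[of u n v] unfolding uv
      by (cases "n = 2 * r") (auto simp: filtration_def)
    ultimately show ?thesis by (auto simp del: One_nat_def)
  next
    case False
    show ?thesis by (simp only: coord_outside[OF xc False] coord_outside[OF yc False])
  qed
qed

lemma J_power_eq_filtration:
  assumes r1: "r = 1"
  shows "ideal_power A J n = filtration n"
proof
  show "ideal_power A J n \<subseteq> filtration n" by (rule J_power_subset_filtration)
  have J: "basis_multiple (u, r, v) c \<in> ideal_power A J (Suc 0)" for u v c
    unfolding J_power_1 using r by (auto simp: filtration_def basis_multiple)
  consider "n = 0" | "n = 1" | "n = 2" | "n \<ge> 3" by linarith
  then show "filtration n \<subseteq> ideal_power A J n"
  proof cases
    case 1
    then show ?thesis by (simp add: ideal_power.simps filtration_0)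
  next
    case 2
    then show ?thesis by (simp add: J_power_1)
  next
    case 3
    show ?thesis
    proof
      fix x assume "x \<in> filtration n"
      then have "x \<in> filtration (2 * r)" using 3 r1 by simp
      note x = top_decomposition[OF this]
      have m: "basis_multiple (u, r, v) c \<otimes> basis_multiple (u', r, v') c' \<in> ideal_power A J n" for u v c u' v' c'
        using ideal_power_mult[OF filtration_ideal J J, of u v c u' v' c'] 3 by (simp add: numeral_2_eq_2)
      show "x \<in> ideal_power A J n"
        by (subst x) (intro additive_subgroup.a_closed[OF ideal.axioms(1)[OF J_power_ideal]] m)
    qed
  next
    case 4
    show ?thesis
    proof
      fix x assume "x \<in> filtration n"
      then have "x \<in> filtration (2 * r + 1)" using 4 r1 by (auto simp: filtration_def)
      then have "x = \<zero>" by (simp only: filtration_top)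
      then show "x \<in> ideal_power A J n"
        using additive_subgroup.zero_closed[OF ideal.axioms(1)[OF J_power_ideal]] by simp
    qed
  qed
qed

definition homogeneous_part :: "nat \<Rightarrow> 'a \<Rightarrow> 'a" where
  "homogeneous_part i x = of_coords (\<lambda>(u, m, v). if m = i then coord x (u, m, v) else 0)"

lemma homogeneous_part_closed [simp]: "homogeneous_part i x \<in> carrier A"
  by (simp add: homogeneous_part_def of_coords)

lemma coord_homogeneous_part:
  "x \<in> carrier A \<Longrightarrow> coord (homogeneous_part i x) (u, m, v) = (if m = i then coord x (u, m, v) else 0)"
  by (simp add: homogeneous_part_def of_coords coord_outside)

lemma homogeneous_part_in_filtration: "x \<in> carrier A \<Longrightarrow> homogeneous_part i x \<in> filtration i"
  by (simp add: filtration_def coord_homogeneous_part)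

lemma rcos_homogeneous_part_eq_iff:
  "x \<in> carrier A \<Longrightarrow> y \<in> carrier A \<Longrightarrow>
    filtration (Suc i) +> homogeneous_part i x = filtration (Suc i) +> homogeneous_part i y \<longleftrightarrow>
    (\<forall>u v. coord x (u, i, v) = coord y (u, i, v))"
  by (subst rcos_eq_iff[OF filtration_ideal])
    (auto simp: filtration_def coord_minus coord_homogeneous_part less_Suc_eq)

lemma coord_finsum:
  "finite S \<Longrightarrow> f \<in> S \<rightarrow> carrier A \<Longrightarrow> coord (finsum A f S) b = (\<Sum>i\<in>S. coord (f i) b)"
  by (induction S rule: finite_induct) (auto simp: coord_zero coord_add finsum_insert)

text \<open>
  The weight is additive on products, which makes the coordinates of the product a Cauchy product.
\<close>

lemma homogeneous_part_mult:
  assumes x: "x \<in> carrier A" and y: "y \<in> carrier A"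
  shows "homogeneous_part n (x \<otimes> y) = finsum A (\<lambda>i. homogeneous_part i x \<otimes> homogeneous_part (n - i) y) {..n}"
proof (rule coord_inject)
  fix b :: "nat \<times> nat \<times> nat"
  obtain u m w where b: "b = (u, m, w)" by (cases b)
  have xy: "x \<otimes> y \<in> carrier A" using x y by simp
  have "coord (finsum A (\<lambda>i. homogeneous_part i x \<otimes> homogeneous_part (n - i) y) {..n}) b
      = (\<Sum>i\<le>n. coord (homogeneous_part i x \<otimes> homogeneous_part (n - i) y) b)"
    by (rule coord_finsum) auto
  also have "\<dots> = coord (homogeneous_part n (x \<otimes> y)) b"
  proof (cases "b \<in> basis r \<and> m = n")
    case True
    then have bas: "(u, n, w) \<in> basis r" using b by auto
    have "coord (homogeneous_part i x \<otimes> homogeneous_part (n - i) y) b = (\<Sum>v\<in>{1, 2, 3}. coord x (u, i, v) * coord y (v, n - i, w))"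
      if "i \<le> n" for i
    proof -
      have "coord (homogeneous_part i x \<otimes> homogeneous_part (n - i) y) b = (\<Sum>(l, v)\<in>{..n} \<times> {1, 2, 3}.
          if l = i then coord x (u, i, v) * coord y (v, n - i, w) else 0)"
        unfolding b conjunct2[OF True] coord_mult[OF homogeneous_part_closed homogeneous_part_closed bas]
        by (rule sum.cong) (auto simp: coord_homogeneous_part x y)
      also have "\<dots> = (\<Sum>l\<le>n. \<Sum>v\<in>{1, 2, 3}. if l = i then coord x (u, i, v) * coord y (v, n - i, w) else 0)"
        by (simp only: sum.cartesian_product)
      also have "\<dots> = (\<Sum>l\<le>n. if l = i then (\<Sum>v\<in>{1, 2, 3}. coord x (u, i, v) * coord y (v, n - i, w)) else 0)"
        by (rule sum.cong) auto
      finally show ?thesis using that by simp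
    qed
    then have "(\<Sum>i\<le>n. coord (homogeneous_part i x \<otimes> homogeneous_part (n - i) y) b)
        = (\<Sum>i\<le>n. \<Sum>v\<in>{1, 2, 3}. coord x (u, i, v) * coord y (v, n - i, w))" by simp
    also have "\<dots> = coord (x \<otimes> y) (u, n, w)"
      unfolding coord_mult[OF x y bas] by (simp only: sum.cartesian_product)
    finally show ?thesis using True by (simp add: b coord_homogeneous_part xy)
  next
    case False
    have "coord (homogeneous_part i x \<otimes> homogeneous_part (n - i) y) b = 0" if "i \<le> n" for i
    proof (cases "b \<in> basis r")
      case True
      then have "m \<noteq> n" using False by blast
      then show ?thesis
        using True that unfolding b
        by (subst coord_mult) (auto intro!: sum.neutral simp: coord_homogeneous_part x y)
    qed (simp add: coord_outside)
    then have "(\<Sum>i\<le>n. coord (homogeneous_part i x \<otimes> homogeneous_part (n - i) y) b) = 0" by simp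
    moreover have "coord (homogeneous_part n (x \<otimes> y)) b = 0"
      using False unfolding b by (auto simp: coord_homogeneous_part xy coord_outside)
    ultimately show ?thesis by simp
  qed
  finally show "coord (homogeneous_part n (x \<otimes> y)) b = coord (finsum A (\<lambda>i. homogeneous_part i x \<otimes> homogeneous_part (n - i) y) {..n}) b" ..
qed (auto intro!: finsum_closed)

lemma homogeneous_part_add:
  "x \<in> carrier A \<Longrightarrow> y \<in> carrier A \<Longrightarrow> homogeneous_part i (x \<oplus> y) = homogeneous_part i x \<oplus> homogeneous_part i y"
  by (rule coord_inject) (auto simp: coord_homogeneous_part coord_add)

lemma homogeneous_part_smult: "x \<in> carrier A \<Longrightarrow> homogeneous_part i (c \<odot> x) = c \<odot> homogeneous_part i x"
  by (rule coord_inject) (auto simp: coord_homogeneous_part coord_smult smult_closed)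

lemma homogeneous_part_one: "homogeneous_part i \<one> = (if i = 0 then \<one> else \<zero>)"
  by (rule coord_inject) (auto simp: coord_homogeneous_part coord_one coord_zero)

lemma smult_add:
  "x \<in> carrier A \<Longrightarrow> y \<in> carrier A \<Longrightarrow> c \<odot> (x \<oplus> y) = c \<odot> x \<oplus> c \<odot> y"
  by (rule coord_inject) (auto simp: smult_closed coord_smult coord_add distrib_left)

lemma filtration_rcos_add:
  "x \<in> carrier A \<Longrightarrow> y \<in> carrier A \<Longrightarrow> (filtration n +> x) <+> (filtration n +> y) = filtration n +> (x \<oplus> y)"
  by (rule abelian_subgroup.a_rcos_sum[OF abelian_subgroupI3[OF ideal.axioms(1)[OF filtration_ideal] abelian_group_axioms]])

text \<open>
  An element is recovered from its homogeneous parts, and the part of weight \<open>i\<close> is determined by its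
  coset modulo the elements of weight above \<open>i\<close>.
\<close>

lemma tightly_graded_if_r_1:
  assumes r1: "r = 1"
  shows "tightly_graded A"
proof -
  note P = J_power_eq_filtration[OF r1]
  let ?G = "gr_alg A J"
  define h where "h x = (\<lambda>i. filtration (Suc i) +> homogeneous_part i x)" for x
  have carr: "f \<in> carrier ?G \<longleftrightarrow> (\<forall>i. \<exists>x\<in>filtration i. f i = filtration (Suc i) +> x) \<and>
      finite {i. f i \<noteq> filtration (Suc i)}" for f
    unfolding gr_alg_simps(1) P gr_component_iff by simp
  have closed: "h x \<in> carrier ?G" if x: "x \<in> carrier A" for x
  proof -
    have "h x i = filtration (Suc i)" if "i > 2 * r" for i
    proof -
      have "coord x (u, i, v) = 0" for u v
        using coord_outside[OF x] basis_bounds[of u i v] that by fastforce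
      then show ?thesis
        unfolding h_def using rcos_eq_self_iff[OF filtration_ideal, of "homogeneous_part i x" "Suc i"] x
        by (auto simp: filtration_def coord_homogeneous_part)
    qed
    then have "{i. h x i \<noteq> filtration (Suc i)} \<subseteq> {..2 * r}" by (auto simp: not_less[symmetric])
    then show ?thesis
      unfolding carr using homogeneous_part_in_filtration[OF x] by (auto simp: h_def intro: finite_subset)
  qed
  have "h \<in> ring_iso A ?G"
  proof (rule ring_iso_memI)
    fix x y assume x: "x \<in> carrier A" and y: "y \<in> carrier A"
    show "h x \<in> carrier ?G" by (rule closed[OF x])
    show "h (x \<oplus> y) = h x \<oplus>\<^bsub>?G\<^esub> h y"
      by (rule ext) (simp add: gr_alg_simps(5) h_def homogeneous_part_add x y filtration_rcos_add)
    show "h (x \<otimes> y) = h x \<otimes>\<^bsub>?G\<^esub> h y"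
    proof
      fix n
      interpret K: ideal "filtration (Suc n)" A by (rule filtration_ideal)
      interpret Q: ring "A Quot filtration (Suc n)" by (rule K.quotient_is_ring)
      have summand: "gr_prod A J i (n - i) (h x i) (h y (n - i)) = filtration (Suc n) +> (homogeneous_part i x \<otimes> homogeneous_part (n - i) y)"
        if "i \<in> {..n}" for i
        using gr_prod_rcos[OF filtration_ideal[of "Suc 0"], of "homogeneous_part i x" i "homogeneous_part (n - i) y" "n - i"] that
          homogeneous_part_in_filtration[OF x] homogeneous_part_in_filtration[OF y] unfolding P h_def by simp
      have "(h x \<otimes>\<^bsub>?G\<^esub> h y) n = finsum (A Quot filtration (Suc n))
          (\<lambda>i. filtration (Suc n) +> (homogeneous_part i x \<otimes> homogeneous_part (n - i) y)) {..n}"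
        unfolding gr_alg_simps(2) P
        by (rule Q.add.finprod_cong'[OF refl _ summand]) (auto intro!: ring_hom_closed[OF K.rcos_ring_hom])
      also have "\<dots> = filtration (Suc n) +> finsum A (\<lambda>i. homogeneous_part i x \<otimes> homogeneous_part (n - i) y) {..n}"
        by (rule K.rcos_finsum) auto
      finally show "h (x \<otimes> y) n = (h x \<otimes>\<^bsub>?G\<^esub> h y) n"
        by (simp only: h_def homogeneous_part_mult[OF x y])
    qed
  next
    show "h \<one> = \<one>\<^bsub>?G\<^esub>"
    proof
      fix i
      have "filtration (Suc i) +> \<zero> = filtration (Suc i)"
        by (rule a_rcos_zero[OF filtration_ideal
              additive_subgroup.zero_closed[OF ideal.axioms(1)[OF filtration_ideal]]])
      then show "h \<one> i = \<one>\<^bsub>?G\<^esub> i"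
        unfolding gr_alg_simps(3) P h_def homogeneous_part_one by simp
    qed
  next
    show "bij_betw h (carrier A) (carrier ?G)"
    proof (rule bij_betw_imageI)
      show "inj_on h (carrier A)"
      proof (rule inj_onI, rule coord_inject)
        fix x y and b :: "nat \<times> nat \<times> nat" assume xy: "x \<in> carrier A" "y \<in> carrier A" "h x = h y"
        obtain u m v where b: "b = (u, m, v)" by (cases b)
        have "h x m = h y m" by (simp only: xy(3))
        then show "coord x b = coord y b"
          unfolding h_def rcos_homogeneous_part_eq_iff[OF xy(1,2)] b by blast
      qed
      have "f \<in> h ` carrier A" if f: "f \<in> carrier ?G" for f
      proof -
        have "\<forall>i. \<exists>x\<in>filtration i. f i = filtration (Suc i) +> x" using f carr by blast
        then obtain z where z: "\<And>i. z i \<in> filtration i" "\<And>i. f i = filtration (Suc i) +> z i" by metis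
        have zc: "z i \<in> carrier A" for i using z(1)[of i] by (simp add: filtration_def)
        define x where "x = of_coords (\<lambda>(u, m, v). coord (z m) (u, m, v))"
        have x: "x \<in> carrier A" by (simp add: x_def of_coords)
        have cx: "coord x (u, m, v) = coord (z m) (u, m, v)" for u m v
          by (simp add: x_def of_coords coord_outside zc)
        have "h x i = f i" for i
        proof -
          have "homogeneous_part i x \<ominus> z i \<in> filtration (Suc i)"
            using z(1)[of i] zc[of i]
            by (auto simp: filtration_def coord_minus coord_homogeneous_part x cx less_Suc_eq)
          then show ?thesis
            unfolding h_def z(2) using rcos_eq_iff[OF filtration_ideal homogeneous_part_closed zc] by blast
        qed
        then show ?thesis using x by blast
      qed
      then show "h ` carrier A = carrier ?G" using closed by blast
    qed
  qed
  moreover have "h (c \<odot> x) = c \<odot>\<^bsub>?G\<^esub> h x" if x: "x \<in> carrier A" for c x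
  proof
    fix i
    have "smult_coset A (filtration (Suc i)) c (filtration (Suc i) +> homogeneous_part i x)
        = filtration (Suc i) +> (c \<odot> homogeneous_part i x)"
      by (rule smult_coset_rcos[OF filtration_ideal])
        (auto simp: smult_closed smult_add filtration_def coord_smult)
    then show "h (c \<odot> x) i = (c \<odot>\<^bsub>?G\<^esub> h x) i"
      unfolding gr_alg_simps(6) P h_def by (simp add: homogeneous_part_smult x)
  qed
  ultimately have "h \<in> alg_iso A ?G" by (auto simp: alg_iso_def)
  then show ?thesis
    unfolding tightly_graded_def isomorphic_algs_def jacobson_radical_eq_J by blast
qed

end

section \<open>The case \<open>r \<ge> 2\<close>\<close>

context B_coordinates
begin

lemma J_subset_carrier: "J \<subseteq> carrier A"
  by (auto simp: filtration_def)

lemma basis_multiple_in_J: "m > 0 \<Longrightarrow> basis_multiple (u, m, v) c \<in> J"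
  by (auto simp: filtration_def basis_multiple)

lemma J_power_rcos_eq_self: "x \<in> carrier A \<Longrightarrow> ideal_power A J n +> x = ideal_power A J n \<longleftrightarrow> x \<in> ideal_power A J n"
  by (rule rcos_eq_self_iff[OF J_power_ideal])

text \<open>
  These are the triples of the four arrows of weight \<open>r\<close>. They do not decompose into two triples of
  positive weight.
\<close>

lemma coord_J_square:
  assumes "x \<in> ideal_power A J 2" "(u, r, v) \<in> basis r" "(u = 1) \<noteq> (v = 1)"
  shows "coord x (u, r, v) = 0"
proof -
  have "x \<in> ideal_prod A J J"
    using assms(1) J_power_1 by (simp add: numeral_2_eq_2 ideal_power.simps)
  then show ?thesis
  proof (induction x rule: ideal_prod.induct)
    case (prod y z)
    then have yz: "y \<in> carrier A" "z \<in> carrier A" using J_subset_carrier by auto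
    have "coord y (u, m, w) * coord z (w, r - m, v) = 0" if "m \<le> r" for m w
    proof (rule ccontr)
      assume ne: "coord y (u, m, w) * coord z (w, r - m, v) \<noteq> 0"
      then have "(u, m, w) \<in> basis r" "(w, r - m, v) \<in> basis r"
        using coord_outside[OF yz(1)] coord_outside[OF yz(2)] by force+
      moreover have "m \<noteq> 0"
      proof
        assume "m = 0"
        then show False using ne prod(1) by (simp add: filtration_def)
      qed
      moreover have "m \<noteq> r"
      proof
        assume "m = r"
        then show False using ne prod(2) by (simp add: filtration_def)
      qed
      ultimately show False
        using \<open>m \<le> r\<close> assms(3) r by (auto simp: basis_def split: if_splits)
    qed
    then show ?case
      unfolding coord_mult[OF yz assms(2)] by (intro sum.neutral) auto
  next
    case (sum s t)
    moreover have "s \<in> carrier A" "t \<in> carrier A"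
      using sum(1,2) ideal_prod_in_carrier[OF filtration_ideal filtration_ideal] by auto
    ultimately show ?case by (simp add: coord_add)
  qed
qed

lemma d1_not_in_J_square: "basis_multiple (2, r, 1) 1 \<notin> ideal_power A J 2"
proof
  assume "basis_multiple (2, r, 1) 1 \<in> ideal_power A J 2"
  from coord_J_square[OF this, of 2 1] show False
    by (simp add: basis_multiple basis_def)
qed

text \<open>
  Of the classes of positive weight that start at 1, only \<open>c\<^sub>1\<close> is not annihilated by \<open>d\<^sub>1\<close>, and \<open>d\<^sub>1c\<^sub>1\<close>
  is the class of weight \<open>2r\<close> at 2.
\<close>

lemma d1_mult_J:
  assumes y: "y \<in> J"
  shows "basis_multiple (2, r, 1) 1 \<otimes> y = basis_multiple (2, 2 * r, 2) (coord y (1, r, 2))"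
proof (rule coord_inject)
  have yc: "y \<in> carrier A" using y J_subset_carrier by auto
  show mc: "basis_multiple (2, r, 1) 1 \<otimes> y \<in> carrier A" using yc by (simp add: basis_multiple)
  show bc: "basis_multiple (2, 2 * r, 2) (coord y (1, r, 2)) \<in> carrier A" by (rule basis_multiple)
  fix b
  show "coord (basis_multiple (2, r, 1) 1 \<otimes> y) b = coord (basis_multiple (2, 2 * r, 2) (coord y (1, r, 2))) b"
  proof (cases "b \<in> basis r")
    case True
    obtain u n v where b: "b = (u, n, v)" by (cases b)
    have d: "(2, r, 1) \<in> basis r" by (simp add: basis_def)
    have z: "coord y (1, n - r, v) = 0" if "u = 2" "r \<le> n" "\<not> (n = 2 * r \<and> v = 2)"
    proof (cases "n = r")
      case True
      then show ?thesis using y by (simp add: filtration_def)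
    next
      case False
      then have "(1, n - r, v) \<notin> basis r"
        using that True r unfolding b by (auto simp: basis_def split: if_splits) presburger
      then show ?thesis by (rule coord_outside[OF yc])
    qed
    have "coord (basis_multiple (2, r, 1) 1 \<otimes> y) b = (if u = 2 \<and> r \<le> n then coord y (1, n - r, v) else 0)"
      using coord_basis_multiple_mult[OF yc d True[unfolded b], of 1] unfolding b by auto
    then show ?thesis
      using z True unfolding b by (auto simp: basis_multiple)
  next
    case False
    show ?thesis by (simp only: coord_outside[OF mc False] coord_outside[OF bc False])
  qed
qed

text \<open>
  The word \<open>(c\<^sub>2d\<^sub>2)\<^sup>r\<close> is the product of \<open>c\<^sub>2\<close>, \<open>d\<^sub>2\<close> and \<open>(c\<^sub>2d\<^sub>2)\<^sup>r\<^sup>-\<^sup>1\<close>, and the last factor lies in the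
  radical since \<open>r \<ge> 2\<close>.
\<close>

lemma full_alternating_word_in_J_cube:
  assumes "r \<ge> 2"
  shows "basis_multiple (2, 2 * r, 2) c \<in> ideal_power A J 3"
proof -
  have "basis_multiple (2, 2 * r, 2) c
      = basis_multiple (2, 1, 3) c \<otimes> (basis_multiple (3, 1, 2) 1 \<otimes> basis_multiple (2, 2 * r - 2, 2) 1)" (is "?x = ?y")
  proof (rule coord_inject)
    show xc: "?x \<in> carrier A" and yc: "?y \<in> carrier A" by (simp_all add: basis_multiple)
    have b: "(2, 1, 3) \<in> basis r" "(3, 1, 2) \<in> basis r" "(2, 2 * r - 2, 2) \<in> basis r"
      "(2, 2 * r, 2) \<in> basis r"
      using assms by (auto simp: basis_def)
    show "coord ?x b = coord ?y b" for b
    proof (cases "b \<in> basis r")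
      case True
      obtain u n v where uv: "b = (u, n, v)" by (cases b)
      have "coord ?y b = (if 2 = u \<and> 1 \<le> n then c * coord (basis_multiple (3, 1, 2) 1 \<otimes> basis_multiple (2, 2 * r - 2, 2) 1) (3, n - 1, v) else 0)"
        unfolding uv by (rule coord_basis_multiple_mult) (use b True uv in \<open>auto simp: basis_multiple\<close>)
      also have "\<dots> = (if u = 2 \<and> n = 2 * r \<and> v = 2 then c else 0)"
      proof (cases "(3, n - 1, v) \<in> basis r")
        case True
        show ?thesis
          unfolding coord_basis_multiple_mult[OF basis_multiple(1) b(2) True]
          using assms b(3) by (auto simp: basis_multiple)
      next
        case False
        have "(3, 2 * r - 1, 2) \<in> basis r" using assms by (auto simp: basis_def)
        then show ?thesis using False by (auto simp: coord_outside basis_multiple)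
      qed
      finally show ?thesis using b(4) by (auto simp: basis_multiple uv)
    next
      case False
      show ?thesis by (simp only: coord_outside[OF xc False] coord_outside[OF yc False])
    qed
  qed
  moreover have "basis_multiple (u, m, v) c' \<in> ideal_power A J (Suc 0)" if "m > 0" for u m v c'
    using basis_multiple_in_J[OF that] by (simp only: J_power_1)
  then have "basis_multiple (2, 1, 3) c \<otimes> (basis_multiple (3, 1, 2) 1 \<otimes> basis_multiple (2, 2 * r - 2, 2) 1)
      \<in> ideal_power A J (Suc 0 + (Suc 0 + Suc 0))"
    using assms by (intro ideal_power_mult[OF filtration_ideal]) auto
  ultimately show ?thesis by (simp add: numeral_3_eq_3)
qed

text \<open>
  Multiplying by an element of the radical raises the power by 1 in general; \<open>d\<^sub>1\<close> raises it by 2, so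
  that its class in degree 1 kills the components of positive degree. For \<open>n = 1\<close> this is
  \<open>d\<^sub>1c\<^sub>1 = (c\<^sub>2d\<^sub>2)\<^sup>r\<close>; for \<open>n \<ge> 2\<close> the product is even zero, because \<open>c\<^sub>1\<close> does not occur in \<open>y\<close>.
\<close>

lemma d1_mult_J_power:
  assumes "r \<ge> 2" and y: "y \<in> ideal_power A J n" and "n \<ge> 1"
  shows "basis_multiple (2, r, 1) 1 \<otimes> y \<in> ideal_power A J (n + 2)"
proof -
  have "ideal_power A J n \<subseteq> J"
    using J_power_subset_filtration[of n] \<open>n \<ge> 1\<close> by (auto simp: filtration_def)
  then have eq: "basis_multiple (2, r, 1) 1 \<otimes> y = basis_multiple (2, 2 * r, 2) (coord y (1, r, 2))"
    using d1_mult_J y by blast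
  show ?thesis
  proof (cases "n = 1")
    case True
    then show ?thesis using full_alternating_word_in_J_cube[OF assms(1)] eq by (simp add: numeral_3_eq_3)
  next
    case False
    obtain k where k: "n = 2 + k" using False \<open>n \<ge> 1\<close> by (metis le_add_diff_inverse One_nat_def Suc_leI le_neq_implies_less numeral_2_eq_2)
    have sub: "ideal_power A J (2 + k) \<subseteq> ideal_power A J 2"
      by (induction k) (use ideal_power_Suc_subset[OF filtration_ideal] in auto)
    have "coord y (1, r, 2) = 0"
      by (rule coord_J_square) (use y k sub in \<open>auto simp: basis_def\<close>)
    moreover have "basis_multiple (2, 2 * r, 2) 0 = \<zero>"
      by (rule coord_inject) (simp_all add: basis_multiple coord_zero)
    ultimately show ?thesis
      using eq additive_subgroup.zero_closed[OF ideal.axioms(1)[OF J_power_ideal]] by simp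
  qed
qed

text \<open>
  Multiplication by the completing class of \<open>basis_dual\<close> moves a coordinate of weight below \<open>2r\<close> to top
  weight.
\<close>

lemma annihilates_J_imp_top:
  assumes a: "a \<in> carrier A" and ann: "\<And>y. y \<in> J \<Longrightarrow> a \<otimes> y = \<zero>"
  shows "a \<in> filtration (2 * r)"
proof -
  have "coord a (u, n, v) = 0" if "n < 2 * r" for u n v
  proof (cases "(u, n, v) \<in> basis r")
    case True
    have d: "(v, 2 * r - n, u) \<in> basis r" "(u, 2 * r, u) \<in> basis r"
      using basis_dual[OF True] by auto
    have "a \<otimes> basis_multiple (v, 2 * r - n, u) 1 = \<zero>"
      by (rule ann, rule basis_multiple_in_J) (use that in simp)
    then have "coord (a \<otimes> basis_multiple (v, 2 * r - n, u) 1) (u, 2 * r, u) = 0"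
      by (simp add: coord_zero)
    then show ?thesis
      using that unfolding coord_mult_basis_multiple[OF a d] by simp
  qed (simp add: coord_outside a)
  then show ?thesis using a by (simp add: filtration_def)
qed

lemma gr_mult_component_zero:
  assumes "\<And>i. i \<le> n \<Longrightarrow> gr_prod A J i (n - i) (f i) (g (n - i)) = ideal_power A J (Suc n)"
  shows "(f \<otimes>\<^bsub>gr_alg A J\<^esub> g) n = ideal_power A J (Suc n)"
proof -
  let ?Q = "A Quot ideal_power A J (Suc n)"
  interpret Q: ring ?Q by (rule ideal.quotient_is_ring[OF J_power_ideal])
  have zero: "\<zero>\<^bsub>?Q\<^esub> = ideal_power A J (Suc n)" by (simp only: FactRing_def ring.simps)
  have "finsum ?Q (\<lambda>i. gr_prod A J i (n - i) (f i) (g (n - i))) {..n} = \<zero>\<^bsub>?Q\<^esub>"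
    by (rule Q.add.finprod_one_eqI) (simp add: assms zero)
  then show ?thesis by (simp only: gr_alg_simps(2) zero)
qed

lemma gr_carrierD:
  assumes "f \<in> carrier (gr_alg A J)"
  obtains y where "y \<in> ideal_power A J i" "y \<in> carrier A" "f i = ideal_power A J (Suc i) +> y"
proof -
  have "f i \<in> gr_component A J i" using assms by (simp add: gr_alg_simps(1))
  then obtain y where y: "y \<in> ideal_power A J i" "f i = ideal_power A J (Suc i) +> y"
    unfolding gr_component_iff by blast
  then show thesis using that ideal.Icarr[OF J_power_ideal y(1)] by blast
qed

lemma gr_prod_zero:
  assumes x: "x \<in> ideal_power A J i" and y: "y \<in> ideal_power A J j" and "x \<otimes> y \<in> ideal_power A J (Suc (i + j))"
  shows "gr_prod A J i j (ideal_power A J (Suc i) +> x) (ideal_power A J (Suc j) +> y) = ideal_power A J (Suc (i + j))"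
  unfolding gr_prod_rcos[OF filtration_ideal x y]
  by (rule a_rcos_zero[OF J_power_ideal assms(3)])

lemma J_power_zero: "\<zero> \<in> ideal_power A J n"
  by (rule additive_subgroup.zero_closed[OF ideal.axioms(1)[OF J_power_ideal]])

lemma J_power_rcos_zero: "ideal_power A J n +> \<zero> = ideal_power A J n"
  by (rule a_rcos_zero[OF J_power_ideal J_power_zero])

definition d1_class :: "nat \<Rightarrow> 'a set" where
  "d1_class i = (if i = 1 then ideal_power A J 2 +> basis_multiple (2, r, 1) 1 else ideal_power A J (Suc i))"

lemma d1_in_J: "basis_multiple (2, r, 1) 1 \<in> ideal_power A J (Suc 0)"
  unfolding J_power_1 using r by (intro basis_multiple_in_J) simp

lemma d1_class_closed: "d1_class \<in> carrier (gr_alg A J)"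
proof -
  have "d1_class i \<in> gr_component A J i" for i
    unfolding gr_component_iff d1_class_def
    using d1_in_J J_power_zero[of i] J_power_rcos_zero[of "Suc i"]
    by (cases "i = 1") (auto simp: numeral_2_eq_2)
  moreover have "finite {i. d1_class i \<noteq> ideal_power A J (Suc i)}"
    by (rule finite_subset[of _ "{1}"]) (auto simp: d1_class_def)
  ultimately show ?thesis by (simp add: gr_alg_simps(1))
qed

lemma d1_class_annihilates:
  assumes r2: "r \<ge> 2" and f: "f \<in> carrier (gr_alg A J)" and f0: "f 0 = ideal_power A J (Suc 0)"
  shows "d1_class \<otimes>\<^bsub>gr_alg A J\<^esub> f = \<zero>\<^bsub>gr_alg A J\<^esub>"
proof
  fix n
  have "gr_prod A J i (n - i) (d1_class i) (f (n - i)) = ideal_power A J (Suc n)" if i: "i \<le> n" for i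
  proof -
    obtain y where y: "y \<in> ideal_power A J (n - i)" "y \<in> carrier A"
      "f (n - i) = ideal_power A J (Suc (n - i)) +> y"
      using gr_carrierD[OF f] by blast
    show ?thesis
    proof (cases "i = 1")
      case False
      have "gr_prod A J i (n - i) (ideal_power A J (Suc i) +> \<zero>) (ideal_power A J (Suc (n - i)) +> y)
          = ideal_power A J (Suc (i + (n - i)))"
        by (rule gr_prod_zero[OF J_power_zero y(1)]) (simp add: y(2) J_power_zero)
      then show ?thesis using False i y(3) by (simp add: d1_class_def J_power_rcos_zero)
    next
      case True
      obtain z where z: "z \<in> ideal_power A J (n - 1)" "f (n - 1) = ideal_power A J (Suc (n - 1)) +> z"
        "basis_multiple (2, r, 1) 1 \<otimes> z \<in> ideal_power A J (Suc n)"
      proof (cases "n = 1")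
        case True
        then show thesis
          using that[of \<zero>] f0 J_power_zero J_power_rcos_zero by (simp add: basis_multiple)
      next
        case False
        then have "n - 1 \<ge> 1" using i True by simp
        then show thesis
          using that[of y] y True i d1_mult_J_power[OF r2, of y "n - 1"] by simp
      qed
      have "gr_prod A J (Suc 0) (n - 1) (ideal_power A J (Suc (Suc 0)) +> basis_multiple (2, r, 1) 1)
          (ideal_power A J (Suc (n - 1)) +> z) = ideal_power A J (Suc (Suc 0 + (n - 1)))"
        by (rule gr_prod_zero[OF d1_in_J z(1)]) (use z(3) i True in simp)
      then show ?thesis using True i z(2) by (simp add: d1_class_def numeral_2_eq_2)
    qed
  qed
  then show "(d1_class \<otimes>\<^bsub>gr_alg A J\<^esub> f) n = \<zero>\<^bsub>gr_alg A J\<^esub> n"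
    unfolding gr_alg_simps(4) by (rule gr_mult_component_zero)
qed

text \<open>
  So the degree 0 component is multiplicative, as a map to \<open>A / J\<close>.
\<close>

lemma gr_mult_component_0:
  assumes z: "z \<in> carrier A" "f 0 = J +> z" and w: "w \<in> carrier A" "g 0 = J +> w"
  shows "(f \<otimes>\<^bsub>gr_alg A J\<^esub> g) 0 = J +> (z \<otimes> w)"
proof -
  interpret Q: ring "A Quot J" by (rule ideal.quotient_is_ring[OF filtration_ideal])
  have P1: "ideal_power A J (Suc 0) = J" using J_power_1 by simp
  have prod: "gr_prod A J 0 0 (f 0) (g 0) = J +> (z \<otimes> w)"
    using gr_prod_rcos[OF filtration_ideal[of "Suc 0"], of z 0 w 0] z w
    by (simp add: P1 ideal_power.simps(1))
  have c: "J +> (z \<otimes> w) \<in> carrier (A Quot J)"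
    by (rule ring_hom_closed[OF ideal.rcos_ring_hom[OF filtration_ideal]]) (use z w in simp)
  show ?thesis
    unfolding gr_alg_simps(2) P1 using c by (simp add: prod Q.finsum_insert)
qed

lemma gr_mult_component_1:
  assumes f: "f \<in> carrier (gr_alg A J)" "f 0 = ideal_power A J (Suc 0)"
    and g: "g \<in> carrier (gr_alg A J)" "g 0 = ideal_power A J (Suc 0)"
  shows "(f \<otimes>\<^bsub>gr_alg A J\<^esub> g) 1 = ideal_power A J 2"
proof -
  have "gr_prod A J i (1 - i) (f i) (g (1 - i)) = ideal_power A J (Suc (Suc 0))" if "i \<le> 1" for i
  proof -
    obtain y where y: "y \<in> ideal_power A J (Suc 0)" "y \<in> carrier A" "f 1 = ideal_power A J (Suc (Suc 0)) +> y"
      unfolding One_nat_def by (rule gr_carrierD[OF f(1), of "Suc 0"])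
    obtain z where z: "z \<in> ideal_power A J (Suc 0)" "z \<in> carrier A" "g 1 = ideal_power A J (Suc (Suc 0)) +> z"
      unfolding One_nat_def by (rule gr_carrierD[OF g(1), of "Suc 0"])
    have P0: "f 0 = ideal_power A J (Suc 0) +> \<zero>" "g 0 = ideal_power A J (Suc 0) +> \<zero>"
      using f(2) g(2) J_power_rcos_zero[of "Suc 0"] by simp_all
    have "gr_prod A J 0 (Suc 0) (f 0) (g 1) = ideal_power A J (Suc (0 + Suc 0))"
      unfolding P0 z(3) using gr_prod_zero[OF J_power_zero[of 0], of z "Suc 0"] z J_power_zero by simp
    moreover have "gr_prod A J (Suc 0) 0 (f 1) (g 0) = ideal_power A J (Suc (Suc 0 + 0))"
      unfolding P0 y(3) using gr_prod_zero[OF _ J_power_zero[of 0], of y "Suc 0"] y J_power_zero by simp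
    moreover have "i = 0 \<or> i = 1" using that by linarith
    ultimately show ?thesis by auto
  qed
  then show ?thesis using gr_mult_component_zero[of 1 f g] by (simp add: numeral_2_eq_2)
qed

lemma J_power_rcos_add:
  "x \<in> carrier A \<Longrightarrow> y \<in> carrier A \<Longrightarrow>
     (ideal_power A J n +> x) <+> (ideal_power A J n +> y) = ideal_power A J n +> (x \<oplus> y)"
  by (rule abelian_subgroup.a_rcos_sum[OF abelian_subgroupI3[OF ideal.axioms(1)[OF J_power_ideal] abelian_group_axioms]])

text \<open>
  Let \<open>a\<close> be the preimage of the class of \<open>d\<^sub>1\<close> under an isomorphism \<open>h\<close>. Since \<open>h\<close> maps the radical to
  elements without degree 0 component, \<open>a\<close> annihilates the radical. Thus \<open>a\<close> has top weight and is a sum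
  of products of elements of the radical, so \<open>h a\<close> has no component in degree 1.
\<close>

lemma not_tightly_graded_if_r_ge_2:
  assumes r2: "r \<ge> 2"
  shows "\<not> tightly_graded A"
proof
  let ?G = "gr_alg A J"
  assume "tightly_graded A"
  then obtain h where "h \<in> ring_iso A ?G"
    unfolding tightly_graded_def isomorphic_algs_def alg_iso_def jacobson_radical_eq_J by blast
  then have h: "h \<in> ring_hom A ?G" "bij_betw h (carrier A) (carrier ?G)" by (auto simp: ring_iso_def)
  note h_closed = ring_hom_closed[OF h(1)] and h_mult = ring_hom_mult[OF h(1)]
    and h_add = ring_hom_add[OF h(1)] and h_one = ring_hom_one[OF h(1)]
  \<comment> \<open>Without the ring axioms for the graded algebra, this follows from z + z = z for a representative z.\<close>
  have h_zero: "h \<zero> = \<zero>\<^bsub>?G\<^esub>"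
  proof
    fix i
    obtain z where z: "z \<in> carrier A" "h \<zero> i = ideal_power A J (Suc i) +> z"
      using gr_carrierD[OF h_closed[OF zero_closed]] by blast
    have "h \<zero> i = h \<zero> i <+> h \<zero> i"
      using h_add[OF zero_closed zero_closed] by (metis gr_alg_simps(5) l_zero zero_closed)
    then have "ideal_power A J (Suc i) +> (z \<oplus> z) = ideal_power A J (Suc i) +> z"
      using J_power_rcos_add[OF z(1) z(1)] by (simp add: z(2))
    then have "(z \<oplus> z) \<ominus> z \<in> ideal_power A J (Suc i)"
      using rcos_eq_iff[OF J_power_ideal] z(1) by blast
    then have "z \<in> ideal_power A J (Suc i)" using z(1) by (simp add: minus_eq a_assoc r_neg)
    then show "h \<zero> i = \<zero>\<^bsub>?G\<^esub> i"
      by (simp add: z gr_alg_simps(4) J_power_rcos_eq_self)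
  qed
  have P1: "ideal_power A J (Suc 0) = J" using J_power_1 by simp
  \<comment> \<open>As y is nilpotent, so is its degree 0 component in A / J, a product of three fields.\<close>
  have h_J: "h y 0 = ideal_power A J (Suc 0)" if y: "y \<in> J" for y
  proof -
    have yc: "y \<in> carrier A" using y J_subset_carrier by auto
    obtain z where z: "z \<in> carrier A" "h y 0 = J +> z"
      using gr_carrierD[OF h_closed[OF yc], of 0] P1 by metis
    have pow: "h (y [^] n) 0 = J +> z [^] n" for n :: nat
    proof (induction n)
      case 0
      then show ?case using h_one J_power_1 by (simp add: gr_alg_simps(3))
    next
      case (Suc n)
      have "h (y [^] Suc n) = h (y [^] n) \<otimes>\<^bsub>?G\<^esub> h y" using h_mult yc by simp
      then show ?case using gr_mult_component_0[where f = "h (y [^] n)" and g = "h y", OF _ Suc z] z(1) by simp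
    qed
    have "y [^] (2 * r + 1) = \<zero>" using filtration_power[OF y, of "2 * r + 1"] by (simp only: filtration_top)
    then have "J +> z [^] (2 * r + 1) = J"
      using pow[of "2 * r + 1"] h_zero by (simp only: gr_alg_simps(4) P1)
    then have zJ: "z [^] (2 * r + 1) \<in> J"
      using rcos_eq_self_iff[OF filtration_ideal] z(1) by blast
    have "coord z (u, 0, u) = 0" if u: "u \<in> {1, 2, 3}" for u
    proof -
      have "coord (z [^] n) (u, 0, u) = coord z (u, 0, u) ^ n" for n :: nat
      proof (induction n)
        case 0
        show ?case using u by (simp only: nat_pow_0 coord_one power_0) simp
      next
        case (Suc n)
        then show ?case using coord_vertex_mult[of "z [^] n" z u] z(1) u by simp
      qed
      moreover have "coord (z [^] (2 * r + 1)) (u, 0, u) = 0" using zJ by (simp add: filtration_def)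
      ultimately show ?thesis by (metis power_not_zero)
    qed
    then have "z \<in> J" unfolding J_iff using z(1) by blast
    then show ?thesis
      using rcos_eq_self_iff[OF filtration_ideal z(1)] z(2) J_power_1 by simp
  qed
  obtain a where a: "a \<in> carrier A" "h a = d1_class"
    using d1_class_closed h(2) by (metis bij_betw_imp_surj_on image_iff)
  have kill: "a \<otimes> y = \<zero>" if y: "y \<in> carrier A" "h y 0 = ideal_power A J (Suc 0)" for y
  proof -
    have "h (a \<otimes> y) = h \<zero>"
      using h_mult[OF a(1) y(1)] d1_class_annihilates[OF r2 h_closed[OF y(1)] y(2)] a(2) h_zero by simp
    then show ?thesis
      using h(2) a(1) y(1) by (auto simp: bij_betw_def dest: inj_onD)
  qed
  have "a \<otimes> y = \<zero>" if "y \<in> J" for y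
    using kill h_J[OF that] that J_subset_carrier by blast
  then have "a \<in> filtration (2 * r)" by (rule annihilates_J_imp_top[OF a(1)])
  note top = top_decomposition[OF this]
  have product: "h (x \<otimes> y) 1 = ideal_power A J 2" if "x \<in> J" "y \<in> J" for x y
  proof -
    have xy: "x \<in> carrier A" "y \<in> carrier A" using that J_subset_carrier by auto
    show ?thesis
      unfolding h_mult[OF xy]
      by (rule gr_mult_component_1[OF h_closed[OF xy(1)] h_J[OF that(1)] h_closed[OF xy(2)] h_J[OF that(2)]])
  qed
  have sum: "h (x \<oplus> y) 1 = ideal_power A J 2"
    if "x \<in> carrier A" "y \<in> carrier A" "h x 1 = ideal_power A J 2" "h y 1 = ideal_power A J 2" for x y
    using h_add[OF that(1,2)] that(3,4) J_power_rcos_add[OF zero_closed zero_closed, of 2]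
    by (simp add: gr_alg_simps(5) J_power_rcos_zero)
  have "h a 1 = ideal_power A J 2"
    by (subst top) (intro sum product basis_multiple_in_J m_closed a_closed basis_multiple(1); use r in simp)
  then have "ideal_power A J 2 +> basis_multiple (2, r, 1) 1 = ideal_power A J 2"
    by (simp add: a(2) d1_class_def)
  then show False
    using J_power_rcos_eq_self[OF basis_multiple(1)] d1_not_in_J_square by blast
qed

end

theorem proposition3p8:
  fixes r :: nat
  assumes "CHAR('k :: alg_closed_field) = 2"
    and "r \<ge> 1"
  shows "tightly_graded (B_alg r :: ('k, ((nat, arrow) qpath \<Rightarrow> 'k) set) module) \<longleftrightarrow> r = 1"
proof -
  interpret B_coordinates "B_alg r :: ('k, ((nat, arrow) qpath \<Rightarrow> 'k) set) module" r "B_coord r"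
    by (rule B_alg_coordinates[OF assms(2)])
  have "r \<ge> 2" if "r \<noteq> 1" using that assms(2) by simp
  then show ?thesis using tightly_graded_if_r_1 not_tightly_graded_if_r_ge_2 by blast
qed

end
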